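(* Let $n\ge 3$. (1) There is a canonical one-to-one correspondence between the set of twisted Coxeter elements of type $D_{n+1}$ and the set of twisted Dynkin quivers of type $D_{n+1}$: a twisted Dynkin quiver $Q^\gets$ corresponds to the twisted Coxeter element $\phi_{Q^\gets}\vee$ such that the reduced words of $\phi_{Q^\gets}$ are adapted to $Q^\gets$. (2) $\{\phi_{Q^\gets}\mid Q^\gets\text{ a twisted Dynkin quiver of type }D_{n+1}\}=\{\phi_{[\mathbf i_0]}\mid[\mathbf i_0]\text{ a twisted adapted class of type }D_{n+1}\}$. (3) If $[\mathbf i_0]$ is a twisted adapted class of reduced words whose twisted Coxeter element is the one corresponding to $Q^\gets$, i.e. $\phi_{[\mathbf i_0]}=\phi_{Q^\gets}$, then $\mathbf i_0$ is adapted to $Q^\gets$.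
   Context: Fix $n\ge 3$. The Dynkin diagram of type $D_{n+1}$ has index set $I=\{1,\dots,n+1\}$ and edges $i-(i+1)$ for $1\le i\le n-1$ together with $(n-1)-(n+1)$; $\alpha_i,s_i$ simple roots and reflections, $W$ the Weyl group, $w_0$ its longest element. $\vee:I\to I$ exchanges $n,n+1$ and fixes other indices; it also denotes the linear map $\alpha_i\mapsto\alpha_{i^\vee}$. For words, $(j_1\cdots j_m)^{k\vee}$ means applying $\vee$ to each letter $k$ times; $\prod$ of words is concatenation; $[\mathbf i]$ is the commutation class of a reduced word. Twisted Coxeter element: $w\vee$ with $w=s_{i_1}\cdots s_{i_n}$, where $i_1,\dots,i_n$ contains exactly one index of each orbit $\{1\},\dots,\{n-1\},\{n,n+1\}$. Twisted adapted classes: the classes of reduced words of $w_0$ obtained from $[\prod_{k=0}^n(1\,2\cdots n)^{k\vee}]$ by repeated operations $[i_1i_2\cdots i_\ell]\mapsto[i_2\cdots i_\ell i_1^*]$ and $[i_1\cdots i_\ell]\mapsto[i_\ell^*i_1\cdots i_{\ell-1}]$ (any representatives; $w_0\alpha_i=-\alpha_{i^*}$). Each is of the form $[\mathbf i_0]=[\prod_{k=0}^n(i_1\cdots i_n)^{k\vee}]$ for a unique twisted Coxeter element $(s_{i_1}\cdots s_{i_n})\vee$, called the twisted Coxeter element of $[\mathbf i_0]$, and $\phi_{[\mathbf i_0]}:=s_{i_1}\cdots s_{i_n}$. Twisted Dynkin quiver $Q^\gets$: an orientation of every edge of the line diagram with $n$ vertices $1-2-\cdots-(n-1)-v$, together with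 a type of the last vertex $v$: either $v=\binom{n}{n+1}$ (symbol $\odot$; denoted $Q^{\gets n}$) or $v=\binom{n+1}{n}$ (symbol $\otimes$; denoted $Q^{\gets n+1}$). For $i\le n-1$, $i$ is a sink (source) if all arrows at vertex $i$ enter (exit) it. The index $n$ is a sink (source) of $Q^{\gets n}$ if the arrow between $n-1$ and $v$ points to $v$ (to $n-1$), and $n$ is neither in $Q^{\gets n+1}$; the index $n+1$ is a sink (source) of $Q^{\gets n+1}$ if the arrow between $n-1$ and $v$ points to $v$ (to $n-1$), and $n+1$ is neither in $Q^{\gets n}$. Reflection $i\,Q^\gets$: if $i\le n-1$ is a sink or source, reverse all arrows at $i$; if $i=n$ and $Q^\gets=Q^{\gets n}$, or $i=n+1$ and $Q^\gets=Q^{\gets n+1}$, switch the type of $v$ ($\odot\leftrightarrow\otimes$) and reverse the arrow at $v$; otherwise $i\,Q^\gets=Q^\gets$. A reduced word $i_1\cdots i_\ell$ is adapted to $Q^\gets$ if $i_k$ is a sink of $i_{k-1}\cdots i_2i_1Q^\gets$ for all $k=1,\dots,\ell$. *)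

theory Defs
  imports Main
begin

section \<open>The Weyl group of type D with n + 1 nodes\<close>

definition index_set :: "nat \<Rightarrow> nat set" where
  "index_set n = {1..n + 1}"

definition dynkin_edges :: "nat \<Rightarrow> nat set set" where
  "dynkin_edges n = {{i, i + 1} | i. 1 \<le> i \<and> i \<le> n - 1} \<union> {{n - 1, n + 1}}"

definition cartan :: "nat \<Rightarrow> nat \<Rightarrow> nat \<Rightarrow> int" where
  "cartan n i j = (if i = j then 2 else if {i, j} \<in> dynkin_edges n then -1 else 0)"

text \<open>
  A vector is the function of its coordinates with respect to the simple roots.
  Coordinates outside \<^term>\<open>index_set n\<close> are inert: all the maps below leave them
  unchanged, so two elements of the Weyl group are equal iff they agree on the root lattice.
\<close>

type_synonym vec = "nat \<Rightarrow> int"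

definition simple_root :: "nat \<Rightarrow> vec" where
  "simple_root i = (\<lambda>j. if j = i then 1 else 0)"

definition simple_refl :: "nat \<Rightarrow> nat \<Rightarrow> vec \<Rightarrow> vec" where
  "simple_refl n i v = (\<lambda>j. v j - (\<Sum>k\<in>index_set n. cartan n i k * v k) * simple_root i j)"

text \<open>The product of simple reflections along a word; the last letter acts first.\<close>

definition word_prod :: "nat \<Rightarrow> nat list \<Rightarrow> vec \<Rightarrow> vec" where
  "word_prod n w = foldr (\<lambda>i g. simple_refl n i \<circ> g) w id"

definition weyl_group :: "nat \<Rightarrow> (vec \<Rightarrow> vec) set" where
  "weyl_group n = word_prod n ` lists (index_set n)"

definition weyl_length :: "nat \<Rightarrow> (vec \<Rightarrow> vec) \<Rightarrow> nat" where
  "weyl_length n g = (LEAST m. \<exists>w \<in> lists (index_set n). word_prod n w = g \<and> length w = m)"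

definition reduced :: "nat \<Rightarrow> nat list \<Rightarrow> bool" where
  "reduced n w \<longleftrightarrow> w \<in> lists (index_set n) \<and> length w = weyl_length n (word_prod n w)"

definition reduced_words :: "nat \<Rightarrow> (vec \<Rightarrow> vec) \<Rightarrow> nat list set" where
  "reduced_words n g = {w. reduced n w \<and> word_prod n w = g}"

definition longest_element :: "nat \<Rightarrow> vec \<Rightarrow> vec" where
  "longest_element n =
    (THE g. g \<in> weyl_group n \<and> (\<forall>h \<in> weyl_group n. weyl_length n h \<le> weyl_length n g))"

definition star :: "nat \<Rightarrow> nat \<Rightarrow> nat" where
  "star n i =
    (THE j. j \<in> index_set n \<and> longest_element n (simple_root i) = - simple_root j)"

definition vee :: "nat \<Rightarrow> nat \<Rightarrow> nat" where
  "vee n i = (if i = n then n + 1 else if i = n + 1 then n else i)"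

text \<open>
  The linear map sending the i-th simple root to the \<open>vee n i\<close>-th one; on coordinates it
  is precomposition with the involution \<^term>\<open>vee n\<close>.
\<close>

definition vee_map :: "nat \<Rightarrow> vec \<Rightarrow> vec" where
  "vee_map n v = (\<lambda>j. v (vee n j))"

section \<open>Commutation classes\<close>

definition comm_step :: "nat \<Rightarrow> nat list \<Rightarrow> nat list \<Rightarrow> bool" where
  "comm_step n u v \<longleftrightarrow>
    (\<exists>xs ys i j. cartan n i j = 0 \<and> u = xs @ [i, j] @ ys \<and> v = xs @ [j, i] @ ys)"

text \<open>
  A single step is symmetric, so the reflexive transitive closure is an equivalence relation.
\<close>

definition comm_class :: "nat \<Rightarrow> nat list \<Rightarrow> nat list set" where
  "comm_class n w = {v. (comm_step n)\<^sup>*\<^sup>* w v}"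

section \<open>Twisted Coxeter elements and twisted adapted classes\<close>

definition vee_orbits :: "nat \<Rightarrow> nat set set" where
  "vee_orbits n = (\<lambda>i. {i, vee n i}) ` index_set n"

definition coxeter_word :: "nat \<Rightarrow> nat list \<Rightarrow> bool" where
  "coxeter_word n w \<longleftrightarrow> w \<in> lists (index_set n) \<and> length w = n \<and>
    (\<forall>X \<in> vee_orbits n. \<exists>!k. k < length w \<and> w ! k \<in> X)"

definition twisted_coxeter_elements :: "nat \<Rightarrow> (vec \<Rightarrow> vec) set" where
  "twisted_coxeter_elements n = {word_prod n w \<circ> vee_map n | w. coxeter_word n w}"

definition twisted_word :: "nat \<Rightarrow> nat list \<Rightarrow> nat list" where
  "twisted_word n w = concat (map (\<lambda>k. map (vee n ^^ k) w) [0..<n + 1])"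

inductive_set reflection_orbit :: "nat \<Rightarrow> nat list set set" for n :: nat where
  base: "comm_class n (twisted_word n [1..<n + 1]) \<in> reflection_orbit n"
| first_to_last: "C \<in> reflection_orbit n \<Longrightarrow> i # w \<in> C \<Longrightarrow>
    comm_class n (w @ [star n i]) \<in> reflection_orbit n"
| last_to_first: "C \<in> reflection_orbit n \<Longrightarrow> w @ [i] \<in> C \<Longrightarrow>
    comm_class n (star n i # w) \<in> reflection_orbit n"

definition twisted_adapted_classes :: "nat \<Rightarrow> nat list set set" where
  "twisted_adapted_classes n =
    reflection_orbit n \<inter> comm_class n ` reduced_words n (longest_element n)"

definition phi_class :: "nat \<Rightarrow> nat list set \<Rightarrow> vec \<Rightarrow> vec" where
  "phi_class n C =
    (THE g. \<exists>w. coxeter_word n w \<and> g = word_prod n w \<and> C = comm_class n (twisted_word n w))"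

section \<open>Twisted Dynkin quivers\<close>

text \<open>
  The vertices of the underlying line are numbered 1 to n, number n being the last
  vertex v, whatever its type. As letters of words, however, n and n + 1 both refer to v.
  A pair \<open>(a, b)\<close> is an arrow from a to b.
\<close>

datatype last_type = Odot | Otimes

datatype twisted_quiver = Twisted_Quiver (arrows: "(nat \<times> nat) set") (last_type: last_type)

definition twisted_quivers :: "nat \<Rightarrow> twisted_quiver set" where
  "twisted_quivers n = {Q.
    arrows Q \<subseteq> {(a, b). {a, b} \<in> {{p, p + 1} | p. 1 \<le> p \<and> p < n}} \<and>
    (\<forall>p. 1 \<le> p \<and> p < n \<longrightarrow> ((p, p + 1) \<in> arrows Q \<longleftrightarrow> (p + 1, p) \<notin> arrows Q))}"

definition sink :: "nat \<Rightarrow> twisted_quiver \<Rightarrow> nat \<Rightarrow> bool" where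
  "sink n Q i \<longleftrightarrow>
    (1 \<le> i \<and> i \<le> n - 1 \<and> (\<forall>(a, b) \<in> arrows Q. a = i \<or> b = i \<longrightarrow> b = i)) \<or>
    (i = n \<and> last_type Q = Odot \<and> (n - 1, n) \<in> arrows Q) \<or>
    (i = n + 1 \<and> last_type Q = Otimes \<and> (n - 1, n) \<in> arrows Q)"

definition source :: "nat \<Rightarrow> twisted_quiver \<Rightarrow> nat \<Rightarrow> bool" where
  "source n Q i \<longleftrightarrow>
    (1 \<le> i \<and> i \<le> n - 1 \<and> (\<forall>(a, b) \<in> arrows Q. a = i \<or> b = i \<longrightarrow> a = i)) \<or>
    (i = n \<and> last_type Q = Odot \<and> (n, n - 1) \<in> arrows Q) \<or>
    (i = n + 1 \<and> last_type Q = Otimes \<and> (n, n - 1) \<in> arrows Q)"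

definition reverse_at :: "nat \<Rightarrow> (nat \<times> nat) set \<Rightarrow> (nat \<times> nat) set" where
  "reverse_at p A = {(a, b). if a = p \<or> b = p then (b, a) \<in> A else (a, b) \<in> A}"

fun switch_type :: "last_type \<Rightarrow> last_type" where
  "switch_type Odot = Otimes"
| "switch_type Otimes = Odot"

definition reflect_quiver :: "nat \<Rightarrow> nat \<Rightarrow> twisted_quiver \<Rightarrow> twisted_quiver" where
  "reflect_quiver n i Q =
    (if 1 \<le> i \<and> i \<le> n - 1 \<and> (sink n Q i \<or> source n Q i)
     then Twisted_Quiver (reverse_at i (arrows Q)) (last_type Q)
     else if (i = n \<and> last_type Q = Odot) \<or> (i = n + 1 \<and> last_type Q = Otimes)
     then Twisted_Quiver (reverse_at n (arrows Q)) (switch_type (last_type Q))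
     else Q)"

text \<open>Positions are counted from 0, so the letter \<open>w ! k\<close> is preceded by \<open>take k w\<close>.\<close>

definition adapted :: "nat \<Rightarrow> twisted_quiver \<Rightarrow> nat list \<Rightarrow> bool" where
  "adapted n Q w \<longleftrightarrow> reduced n w \<and>
    (\<forall>k < length w. sink n (fold (reflect_quiver n) (take k w) Q) (w ! k))"

definition corresponds :: "nat \<Rightarrow> twisted_quiver \<Rightarrow> (vec \<Rightarrow> vec) \<Rightarrow> bool" where
  "corresponds n Q g \<longleftrightarrow>
    g \<circ> vee_map n \<in> twisted_coxeter_elements n \<and> (\<forall>w \<in> reduced_words n g. adapted n Q w)"

definition phi_quiver :: "nat \<Rightarrow> twisted_quiver \<Rightarrow> vec \<Rightarrow> vec" where
  "phi_quiver n Q = (THE g. corresponds n Q g)"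

end

theory Submission
  imports Defs "HOL-Combinatorics.Permutations"
begin

text \<open>
  Forget at first that adapted words are reduced and consider sink sequences: words whose letters
  can be played one after the other as sinks, each being reflected when it is played.  Two sinks
  are never adjacent, so sink sequences can be permuted by commutations (\<open>sink_word_comm_eq\<close>), two
  sink sequences of one quiver with the same letters differ by commutations only
  (\<open>sink_words_comm_eq\<close>), and a sink sequence that plays every vertex determines its quiver
  (\<open>sink_word_quiver_of\<close>): of two neighbours, the one that is played first is the target of the
  arrow.  Conversely a Coxeter word defines a quiver in this way, and reflecting this quiver at
  the first letter of the word corresponds to moving this letter, twisted by \<open>vee\<close>, to the end
  (\<open>reflect_quiver_of\<close>).  Hence a Coxeter word, and the whole twisted word that it generates, is a
  sink sequence of its quiver, and quivers correspond to Coxeter words up to commutations.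

  Words without repeated letters that represent the same group element differ by commutations
  only (\<open>distinct_words_comm_eq\<close>), and all reduced words of a Coxeter element have no repeated
  letters.  So quivers correspond to Coxeter elements, which is the first assertion.

  If the class of a twisted word is rotated by one letter, the result is the class of the twisted
  word of a rotated Coxeter word (\<open>twisted_power_rotate\<close>), and every Coxeter word can be rotated
  to \<open>1 \<dots> n\<close> (\<open>coxeter_word_induct\<close>).  The orbit therefore consists of the classes of all twisted
  words, provided that the involution \<open>star\<close> is \<open>vee\<close> applied \<open>n + 1\<close> times, and the twisted
  adapted classes are all of them, provided that twisted words are reduced words of the longest
  element.  Both provisos are seen in orthogonal coordinates, where the Weyl group acts by signed
  permutations.  A twisted Coxeter element is a cycle of all \<open>n + 1\<close> coordinates with an odd number
  of sign changes, so its power with exponent \<open>n + 1\<close> is \<open>-1\<close> (\<open>twisted_coxeter_power\<close>); thus a twisted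
  word represents the negative of \<open>vee\<close> applied \<open>n + 1\<close> times.  The length of an element is the
  number of positive roots at which the image of a regular dominant vector is negative
  (\<open>weyl_length_eq_height\<close>).  It is at most the number \<open>n (n + 1)\<close> of positive roots, with equality
  for the element just found only (\<open>longest_element_eq\<close>), and this is also the length of a twisted
  word.

  The other two assertions follow, since the words in the class of a twisted word are sink
  sequences that play every vertex, so that the class knows its quiver.
\<close>

section \<open>Commutation equivalence of words\<close>

abbreviation comm_eq :: "nat \<Rightarrow> nat list \<Rightarrow> nat list \<Rightarrow> bool" where
  "comm_eq n \<equiv> (comm_step n)\<^sup>*\<^sup>*"

lemma cartan_sym: "cartan n i j = cartan n j i"
  by (auto simp: cartan_def insert_commute)

lemma cartan_zero_imp_neq: "cartan n i j = 0 \<Longrightarrow> i \<noteq> j"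
  by (auto simp: cartan_def)

lemma comm_step_sym: "comm_step n u v \<Longrightarrow> comm_step n v u"
  unfolding comm_step_def using cartan_sym by metis

lemma comm_eq_sym: "comm_eq n u v \<Longrightarrow> comm_eq n v u"
  by (metis comm_step_sym sympD sympI symp_rtranclp)

lemma comm_class_eq_iff: "comm_class n u = comm_class n v \<longleftrightarrow> comm_eq n u v"
  unfolding comm_class_def using comm_eq_sym by (metis (mono_tags, opaque_lifting) mem_Collect_eq
      rtranclp.rtrancl_refl rtranclp_trans Collect_cong)

lemma comm_eq_map:
  assumes "comm_eq n u v" and step: "\<And>u v. comm_step n u v \<Longrightarrow> comm_eq n (f u) (f v)"
  shows "comm_eq n (f u) (f v)"
  using assms(1) by (induction rule: rtranclp_induct) (auto dest: step intro: rtranclp_trans)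

lemma comm_eq_context:
  assumes "comm_eq n u v"
  shows "comm_eq n (a @ u @ b) (a @ v @ b)"
proof (rule comm_eq_map[OF assms, of "\<lambda>u. a @ u @ b"])
  fix u v assume "comm_step n u v"
  then obtain xs ys i j where "cartan n i j = 0" "u = xs @ [i, j] @ ys" "v = xs @ [j, i] @ ys"
    unfolding comm_step_def by blast
  then have "comm_step n (a @ u @ b) (a @ v @ b)"
    unfolding comm_step_def by (intro exI[of _ "a @ xs"] exI[of _ "ys @ b"] exI[of _ i] exI[of _ j]) simp
  then show "comm_eq n (a @ u @ b) (a @ v @ b)" by blast
qed

lemmas comm_eq_append1 = comm_eq_context[where b = "[]", simplified]
lemmas comm_eq_append2 = comm_eq_context[where a = "[]", simplified]
lemmas comm_eq_Cons = comm_eq_context[where a = "[i]" and b = "[]" for i, simplified]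

lemma comm_eq_rev:
  assumes "comm_eq n u v"
  shows "comm_eq n (rev u) (rev v)"
proof (rule comm_eq_map[OF assms, of rev])
  fix u v assume "comm_step n u v"
  then obtain xs ys i j where "cartan n i j = 0" "u = xs @ [i, j] @ ys" "v = xs @ [j, i] @ ys"
    unfolding comm_step_def by blast
  then have "comm_step n (rev u) (rev v)"
    unfolding comm_step_def using cartan_sym
    by (intro exI[of _ "rev ys"] exI[of _ "rev xs"] exI[of _ j] exI[of _ i]) simp
  then show "comm_eq n (rev u) (rev v)" by blast
qed

lemma comm_eq_mset: "comm_eq n u v \<Longrightarrow> mset u = mset v"
  by (induction rule: rtranclp_induct) (auto simp: comm_step_def)

lemma comm_eq_set: "comm_eq n u v \<Longrightarrow> set u = set v"
  by (metis comm_eq_mset set_mset_mset)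

lemma comm_eq_length: "comm_eq n u v \<Longrightarrow> length u = length v"
  by (metis comm_eq_mset size_mset)

lemma comm_eq_swap: "cartan n i j = 0 \<Longrightarrow> comm_eq n (i # j # w) (j # i # w)"
  unfolding comm_step_def by (intro r_into_rtranclp) (metis append_Cons append_Nil)

lemma comm_eq_move_to_front:
  assumes "\<And>j. j \<in> set x \<Longrightarrow> cartan n j i = 0"
  shows "comm_eq n (x @ i # y) (i # x @ y)"
  using assms
proof (induction x)
  case (Cons j x)
  then have "comm_eq n (j # x @ i # y) (j # i # x @ y)" by (intro comm_eq_Cons) auto
  also have "comm_eq n (j # i # x @ y) (i # j # x @ y)" using Cons.prems by (intro comm_eq_swap) auto
  finally show ?case by simp
qed simp

lemma comm_eq_blocks:
  assumes "\<And>i j. i \<in> set x \<Longrightarrow> j \<in> set y \<Longrightarrow> cartan n i j = 0"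
  shows "comm_eq n (x @ y) (y @ x)"
  using assms
proof (induction y)
  case (Cons j y)
  then have "comm_eq n (x @ j # y) (j # x @ y)" by (intro comm_eq_move_to_front) auto
  also have "comm_eq n (j # x @ y) (j # y @ x)" using Cons by (intro comm_eq_Cons) auto
  finally show ?case by simp
qed simp

text \<open>
  Commutation never moves two equal letters past each other, so deleting the first occurrence of
  a letter is compatible with it.  This makes the commutation monoid cancellative.
\<close>

lemma comm_eq_remove1:
  assumes "comm_eq n u v"
  shows "comm_eq n (remove1 i u) (remove1 i v)"
proof (rule comm_eq_map[OF assms, of "remove1 i"])
  fix u v assume "comm_step n u v"
  then obtain xs ys a b where ab: "cartan n a b = 0" "u = xs @ [a, b] @ ys" "v = xs @ [b, a] @ ys"
    unfolding comm_step_def by blast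
  then have "a \<noteq> b" by (auto dest: cartan_zero_imp_neq)
  then show "comm_eq n (remove1 i u) (remove1 i v)"
    using ab comm_eq_append1[OF comm_eq_swap[OF ab(1)]]
    by (auto simp: remove1_append)
qed

lemma comm_eq_cancel_left: "comm_eq n (i # u) (i # v) \<Longrightarrow> comm_eq n u v"
  using comm_eq_remove1[of n "i # u" "i # v" i] by simp

lemma comm_eq_cancel_right: "comm_eq n (u @ [i]) (v @ [i]) \<Longrightarrow> comm_eq n u v"
  using comm_eq_cancel_left[of n i "rev u" "rev v"] comm_eq_rev[of n "u @ [i]" "v @ [i]"]
    comm_eq_rev[of n "rev u" "rev v"] by simp

text \<open>
  The letters that can be brought to the front are exactly those commuting with everything that
  precedes their first occurrence: this condition survives every commutation.
\<close>

lemma comm_eq_head: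
  assumes "comm_eq n (i # u) t"
  obtains x y where "t = x @ i # y" "\<And>j. j \<in> set x \<Longrightarrow> cartan n j i = 0"
proof -
  have "i \<in> set t \<and> (\<forall>j \<in> set (takeWhile (\<lambda>k. k \<noteq> i) t). cartan n j i = 0)"
    using assms
  proof (induction rule: rtranclp_induct)
    case base then show ?case by simp
  next
    case (step t t')
    then obtain xs ys a b where ab: "cartan n a b = 0" "t = xs @ [a, b] @ ys" "t' = xs @ [b, a] @ ys"
      unfolding comm_step_def by blast
    then show ?case using step.IH cartan_sym[of n a b] cartan_zero_imp_neq[OF ab(1)]
      by (cases "i \<in> set xs") (auto simp: takeWhile_append split: if_splits)
  qed
  then have "t = takeWhile (\<lambda>k. k \<noteq> i) t @ i # tl (dropWhile (\<lambda>k. k \<noteq> i) t)"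
    by (metis (mono_tags, lifting) dropWhile_eq_Nil_conv hd_dropWhile list.collapse
        takeWhile_dropWhile_id)
  with \<open>i \<in> set t \<and> _\<close> that show ?thesis by blast
qed

lemma comm_eq_last:
  assumes "comm_eq n (u @ [i]) t"
  obtains x y where "t = x @ i # y" "\<And>j. j \<in> set y \<Longrightarrow> cartan n j i = 0"
proof -
  have "comm_eq n (i # rev u) (rev t)" using comm_eq_rev[OF assms] by simp
  then obtain x y where "rev t = x @ i # y" "\<And>j. j \<in> set x \<Longrightarrow> cartan n j i = 0"
    by (rule comm_eq_head) blast
  then show ?thesis using that[of "rev y" "rev x"] by (simp add: rev_eq_append_conv)
qed

section \<open>Letters, vertices and Coxeter words\<close>

text \<open>The letters \<open>n\<close> and \<open>n + 1\<close> both refer to the last vertex of the line diagram.\<close>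

definition vertex :: "nat \<Rightarrow> nat \<Rightarrow> nat" where
  "vertex n i = min i n"

definition line_adj :: "nat \<Rightarrow> nat \<Rightarrow> nat \<Rightarrow> bool" where
  "line_adj n a b \<longleftrightarrow> 1 \<le> a \<and> a \<le> n \<and> 1 \<le> b \<and> b \<le> n \<and> (b = a + 1 \<or> a = b + 1)"

lemma line_adj_sym: "line_adj n a b \<longleftrightarrow> line_adj n b a"
  by (auto simp: line_adj_def)

lemma vee_vee [simp]: "vee n (vee n i) = i"
  by (simp add: vee_def)

lemma vee_eq_iff [simp]: "vee n i = vee n j \<longleftrightarrow> i = j"
  by (auto simp: vee_def split: if_splits)

lemma vertex_vee [simp]: "vertex n (vee n i) = vertex n i"
  by (auto simp: vertex_def vee_def)

lemma vee_index [simp]: "n \<ge> 1 \<Longrightarrow> vee n i \<in> index_set n \<longleftrightarrow> i \<in> index_set n"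
  by (auto simp: vee_def index_set_def)

lemma vee_fixed [simp]: "i < n \<Longrightarrow> vee n i = i"
  by (simp add: vee_def)

lemma vee_power_cancel [simp]: "(vee n ^^ k) ((vee n ^^ k) i) = i"
  by (induction k arbitrary: i) (simp_all add: funpow_swap1)

lemma vee_power_index [simp]: "n \<ge> 1 \<Longrightarrow> (vee n ^^ k) i \<in> index_set n \<longleftrightarrow> i \<in> index_set n"
  by (induction k) simp_all

lemma vertex_range: "i \<in> index_set n \<Longrightarrow> n \<ge> 1 \<Longrightarrow> vertex n i \<in> {1..n}"
  by (auto simp: vertex_def index_set_def)

lemma dynkin_edge_iff:
  "{i, j} \<in> dynkin_edges n \<longleftrightarrow> (1 \<le> i \<and> i \<le> n - 1 \<and> j = i + 1) \<or> (1 \<le> j \<and> j \<le> n - 1 \<and> i = j + 1) \<or>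
    (i = n - 1 \<and> j = n + 1) \<or> (i = n + 1 \<and> j = n - 1)"
  by (auto simp: dynkin_edges_def doubleton_eq_iff)

lemma cartan_zero_iff:
  assumes "n \<ge> 3" "i \<in> index_set n" "j \<in> index_set n"
  shows "cartan n i j = 0 \<longleftrightarrow> i \<noteq> j \<and> \<not> line_adj n (vertex n i) (vertex n j)"
  using assms
  unfolding cartan_def dynkin_edge_iff line_adj_def vertex_def index_set_def min_def by auto

lemma vee_edge: assumes "n \<ge> 3"
  shows "{vee n i, vee n j} \<in> dynkin_edges n \<longleftrightarrow> {i, j} \<in> dynkin_edges n"
  using assms unfolding dynkin_edge_iff vee_def by auto

lemma cartan_vee: "n \<ge> 3 \<Longrightarrow> cartan n (vee n i) (vee n j) = cartan n i j"
  by (simp add: cartan_def vee_edge)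

lemma comm_eq_map_vee:
  assumes "n \<ge> 3" "comm_eq n u v"
  shows "comm_eq n (map (vee n) u) (map (vee n) v)"
proof (rule comm_eq_map[OF assms(2), of "map (vee n)"])
  fix u v assume "comm_step n u v"
  then obtain xs ys i j where "cartan n i j = 0" "u = xs @ [i, j] @ ys" "v = xs @ [j, i] @ ys"
    unfolding comm_step_def by blast
  then have "comm_step n (map (vee n) u) (map (vee n) v)"
    unfolding comm_step_def using cartan_vee[OF assms(1)]
    by (intro exI[of _ "map (vee n) xs"] exI[of _ "map (vee n) ys"] exI[of _ "vee n i"]
        exI[of _ "vee n j"]) simp
  then show "comm_eq n (map (vee n) u) (map (vee n) v)" by blast
qed

lemma comm_eq_map_vee_power:
  assumes "n \<ge> 3" "comm_eq n u v"
  shows "comm_eq n (map (vee n ^^ k) u) (map (vee n ^^ k) v)"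
  using assms(2)
proof (induction k)
  case (Suc k)
  have *: "map (vee n ^^ Suc k) x = map (vee n) (map (vee n ^^ k) x)" for x by simp
  show ?case unfolding * by (rule comm_eq_map_vee[OF assms(1) Suc.IH[OF Suc.prems]])
qed simp

text \<open>
  The orbits of \<open>vee\<close> are the fibres of \<^const>\<open>vertex\<close>, so a Coxeter word is an ordering of the
  vertices together with a choice of one of the two letters for the last vertex.
\<close>

lemma coxeter_word_iff:
  assumes "n \<ge> 3"
  shows "coxeter_word n w \<longleftrightarrow>
    set w \<subseteq> index_set n \<and> mset (map (vertex n) w) = mset [1..<n + 1]"
proof -
  have I: "{i, vee n i} = {j \<in> index_set n. vertex n j = vertex n i}" if "i \<in> index_set n" for i
    using that assms by (auto simp: vee_def index_set_def vertex_def min_def)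
  have orbit: "X \<in> vee_orbits n \<longleftrightarrow> (\<exists>p \<in> {1..n}. X = {j \<in> index_set n. vertex n j = p})" for X
  proof
    assume "X \<in> vee_orbits n"
    then obtain i where "i \<in> index_set n" "X = {i, vee n i}" unfolding vee_orbits_def by blast
    then show "\<exists>p \<in> {1..n}. X = {j \<in> index_set n. vertex n j = p}"
      using I[of i] vertex_range[of i n] assms by (intro bexI[of _ "vertex n i"]) auto
  next
    assume "\<exists>p \<in> {1..n}. X = {j \<in> index_set n. vertex n j = p}"
    then obtain p where p: "p \<in> {1..n}" "X = {j \<in> index_set n. vertex n j = p}" by blast
    then have pi: "p \<in> index_set n" and "vertex n p = p" by (auto simp: index_set_def vertex_def)
    then have "X = {p, vee n p}" using I[of p] p by simp
    then show "X \<in> vee_orbits n" unfolding vee_orbits_def using pi by (rule image_eqI)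
  qed
  have orbit_set: "vee_orbits n = (\<lambda>p. {j \<in> index_set n. vertex n j = p}) ` {1..n}"
    using orbit by (intro set_eqI) (simp add: image_iff)
  have "(\<forall>X \<in> vee_orbits n. \<exists>!k. k < length w \<and> w ! k \<in> X) \<longleftrightarrow>
      (\<forall>p \<in> {1..n}. \<exists>!k. k < length w \<and> vertex n (w ! k) = p)" if "set w \<subseteq> index_set n"
  proof -
    have "k < length w \<Longrightarrow> w ! k \<in> index_set n" for k using that nth_mem by blast
    then have "(k < length w \<and> w ! k \<in> {j \<in> index_set n. vertex n j = p}) \<longleftrightarrow>
        (k < length w \<and> vertex n (w ! k) = p)" for k p by blast
    moreover have "(\<forall>X \<in> vee_orbits n. P X) \<longleftrightarrow>
        (\<forall>p \<in> {1..n}. P {j \<in> index_set n. vertex n j = p})" for P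
      unfolding orbit_set by simp
    ultimately show ?thesis by (simp only:)
  qed
  then have 1: "coxeter_word n w \<longleftrightarrow> set w \<subseteq> index_set n \<and> length w = n \<and>
      (\<forall>p \<in> {1..n}. \<exists>!k. k < length w \<and> vertex n (w ! k) = p)"
    unfolding coxeter_word_def lists_eq_set mem_Collect_eq by argo
  let ?l = "map (vertex n) w"
  have sl: "set w \<subseteq> index_set n \<Longrightarrow> set ?l \<subseteq> {1..n}" using vertex_range assms by fastforce
  have 2: "length w = n \<and> (\<forall>p \<in> {1..n}. \<exists>!k. k < length w \<and> vertex n (w ! k) = p)
      \<longleftrightarrow> distinct ?l \<and> set ?l = {1..n}" if I: "set w \<subseteq> index_set n"
  proof
    assume A: "length w = n \<and> (\<forall>p \<in> {1..n}. \<exists>!k. k < length w \<and> vertex n (w ! k) = p)"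
    then have "{1..n} \<subseteq> set ?l" by (force simp: in_set_conv_nth)
    then have s: "set ?l = {1..n}" using sl[OF I] by blast
    then show "distinct ?l \<and> set ?l = {1..n}" using A by (simp add: card_distinct del: set_map)
  next
    assume A: "distinct ?l \<and> set ?l = {1..n}"
    then have "length w = n" by (metis card_atLeastAtMost diff_Suc_1 distinct_card length_map Suc_eq_plus1)
    moreover have "\<exists>!k. k < length w \<and> vertex n (w ! k) = p" if p: "p \<in> {1..n}" for p
    proof -
      obtain k where k: "k < length ?l" "?l ! k = p" using A p by (metis in_set_conv_nth)
      then have "k < length w \<and> vertex n (w ! k) = p" by simp
      then show ?thesis
      proof (rule ex1I)
        fix k' assume "k' < length w \<and> vertex n (w ! k') = p"
        then show "k' = k" using A k nth_eq_iff_index_eq[of ?l k k'] by simp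
      qed
    qed
    ultimately show "length w = n \<and> (\<forall>p \<in> {1..n}. \<exists>!k. k < length w \<and> vertex n (w ! k) = p)" by simp
  qed
  have 3: "distinct ?l \<and> set ?l = {1..n} \<longleftrightarrow> mset ?l = mset [1..<n + 1]"
  proof -
    have "set [1..<n + 1] = {1..n}" by auto
    then show ?thesis by (metis distinct_upt mset_eq_imp_distinct_iff mset_eq_setD set_eq_iff_mset_eq_distinct)
  qed
  show ?thesis using 1 2 3 by argo
qed

section \<open>Sink sequences\<close>

lemma ex_line_adj: "n \<ge> 3 \<Longrightarrow> p \<in> {1..n} \<Longrightarrow> \<exists>q. line_adj n q p"
proof (cases "p = 1")
  case True
  assume "n \<ge> 3"
  with True have "line_adj n 2 p" by (simp add: line_adj_def)
  then show ?thesis ..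
next
  case False
  assume "p \<in> {1..n}"
  with False have "line_adj n (p - 1) p" by (auto simp: line_adj_def)
  then show ?thesis ..
qed

lemma twisted_quivers_iff:
  "Q \<in> twisted_quivers n \<longleftrightarrow> arrows Q \<subseteq> {(a, b). line_adj n a b} \<and>
    (\<forall>a b. line_adj n a b \<longrightarrow> ((a, b) \<in> arrows Q \<longleftrightarrow> (b, a) \<notin> arrows Q))"
proof -
  have 1: "{(a, b). {a, b} \<in> {{p, p + 1} | p. 1 \<le> p \<and> p < n}} = {(a, b). line_adj n a b}"
    by (auto simp: line_adj_def doubleton_eq_iff)
  have 2: "(\<forall>p. 1 \<le> p \<and> p < n \<longrightarrow> ((p, p + 1) \<in> A \<longleftrightarrow> (p + 1, p) \<notin> A)) \<longleftrightarrow>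
      (\<forall>a b. line_adj n a b \<longrightarrow> ((a, b) \<in> A \<longleftrightarrow> (b, a) \<notin> A))" for A :: "(nat \<times> nat) set"
  proof (rule iffI; rule allI; (rule allI)?; rule impI)
    fix a b assume A: "\<forall>p. 1 \<le> p \<and> p < n \<longrightarrow> ((p, p + 1) \<in> A \<longleftrightarrow> (p + 1, p) \<notin> A)"
      and "line_adj n a b"
    then consider "b = a + 1" "1 \<le> a \<and> a < n" | "a = b + 1" "1 \<le> b \<and> b < n"
      by (auto simp: line_adj_def)
    then show "(a, b) \<in> A \<longleftrightarrow> (b, a) \<notin> A"
    proof cases
      case 1 then show ?thesis using A[rule_format, of a] by simp
    next
      case 2 then show ?thesis using A[rule_format, of b] by simp
    qed
  next
    fix p assume A: "\<forall>a b. line_adj n a b \<longrightarrow> ((a, b) \<in> A \<longleftrightarrow> (b, a) \<notin> A)"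
      and "1 \<le> p \<and> p < n"
    then have "line_adj n p (p + 1)" by (simp add: line_adj_def)
    then show "(p, p + 1) \<in> A \<longleftrightarrow> (p + 1, p) \<notin> A" using A by blast
  qed
  show ?thesis unfolding twisted_quivers_def 1 2 by simp
qed

lemma arrow_adj: "Q \<in> twisted_quivers n \<Longrightarrow> (a, b) \<in> arrows Q \<Longrightarrow> line_adj n a b"
  by (auto simp: twisted_quivers_iff)

lemma arrow_reverse:
  "Q \<in> twisted_quivers n \<Longrightarrow> line_adj n a b \<Longrightarrow> (a, b) \<in> arrows Q \<longleftrightarrow> (b, a) \<notin> arrows Q"
  by (auto simp: twisted_quivers_iff)

lemma twisted_quiver_eqI:
  assumes Q: "Q \<in> twisted_quivers n" "Q' \<in> twisted_quivers n"
    and "last_type Q = last_type Q'"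
    and edge: "\<And>p. 1 \<le> p \<Longrightarrow> p < n \<Longrightarrow> (p, p + 1) \<in> arrows Q \<longleftrightarrow> (p, p + 1) \<in> arrows Q'"
  shows "Q = Q'"
proof -
  have "(a, b) \<in> arrows Q \<longleftrightarrow> (a, b) \<in> arrows Q'" for a b
  proof (cases "line_adj n a b")
    case True
    then consider "b = a + 1" "1 \<le> a" "a < n" | "a = b + 1" "1 \<le> b" "b < n"
      by (auto simp: line_adj_def)
    then show ?thesis
      by cases (use edge arrow_reverse[OF Q(1) True] arrow_reverse[OF Q(2) True] in auto)
  qed (use Q arrow_adj in blast)
  then show ?thesis using assms(3) by (intro twisted_quiver.expand) auto
qed

text \<open>
  Uniform in the letter: the vertex of the letter is the target of all its edges, and for the two
  letters of the last vertex the type must allow the letter.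
\<close>

lemma sink_iff:
  assumes "n \<ge> 3" "Q \<in> twisted_quivers n"
  shows "sink n Q i \<longleftrightarrow> i \<in> index_set n \<and> (n \<le> i \<longrightarrow> (i = n \<longleftrightarrow> last_type Q = Odot)) \<and>
    (\<forall>q. line_adj n q (vertex n i) \<longrightarrow> (q, vertex n i) \<in> arrows Q)"
proof -
  have t: "last_type Q = Odot \<or> last_type Q = Otimes" by (cases "last_type Q") auto
  consider "i \<notin> index_set n" | "1 \<le> i" "i < n" | "i = n" | "i = n + 1"
    by (force simp: index_set_def)
  then show ?thesis
  proof cases
    case 2
    have "(\<forall>(a, b) \<in> arrows Q. a = i \<or> b = i \<longrightarrow> b = i) \<longleftrightarrow>
        (\<forall>q. line_adj n q i \<longrightarrow> (q, i) \<in> arrows Q)"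
      using arrow_adj[OF assms(2)] arrow_reverse[OF assms(2)] line_adj_sym by fast
    moreover have "i \<le> n - 1" "i \<noteq> n" "i \<noteq> n + 1" "\<not> n \<le> i" "min i n = i" using 2 by auto
    ultimately show ?thesis using 2 by (simp add: sink_def vertex_def index_set_def)
  qed (use assms(1) t in \<open>auto simp: sink_def vertex_def index_set_def line_adj_def\<close>)
qed

lemma reflect_sink:
  assumes "n \<ge> 3" "sink n Q i"
  shows "reflect_quiver n i Q = Twisted_Quiver (reverse_at (vertex n i) (arrows Q))
    (if i < n then last_type Q else switch_type (last_type Q))"
  using assms unfolding reflect_quiver_def sink_def by (auto simp: vertex_def)

lemma reverse_at_iff:
  "(a, b) \<in> reverse_at p A \<longleftrightarrow> (if a = p \<or> b = p then (b, a) \<in> A else (a, b) \<in> A)"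
  by (simp add: reverse_at_def)

lemma reverse_at_commute: "reverse_at p (reverse_at q A) = reverse_at q (reverse_at p A)"
  by (auto simp: reverse_at_iff split: if_splits)

lemma reflect_twisted_quivers:
  assumes "n \<ge> 3" "Q \<in> twisted_quivers n" "sink n Q i"
  shows "reflect_quiver n i Q \<in> twisted_quivers n"
proof -
  let ?A = "reverse_at (vertex n i) (arrows Q)"
  have "line_adj n a b" if "(a, b) \<in> ?A" for a b
    using that arrow_adj[OF assms(2), of a b] arrow_adj[OF assms(2), of b a] line_adj_sym[of n a b]
    by (auto simp: reverse_at_iff split: if_splits)
  moreover have "(a, b) \<in> ?A \<longleftrightarrow> (b, a) \<notin> ?A" if "line_adj n a b" for a b
    using arrow_reverse[OF assms(2) that] by (auto simp: reverse_at_iff)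
  ultimately show ?thesis
    unfolding reflect_sink[OF assms(1,3)] twisted_quivers_iff twisted_quiver.sel by blast
qed

text \<open>The recursive form of adaptedness, without the requirement that the word be reduced.\<close>

fun sink_word :: "nat \<Rightarrow> twisted_quiver \<Rightarrow> nat list \<Rightarrow> bool" where
  "sink_word n Q [] \<longleftrightarrow> True"
| "sink_word n Q (i # w) \<longleftrightarrow> sink n Q i \<and> sink_word n (reflect_quiver n i Q) w"

lemma adapted_iff: "adapted n Q w \<longleftrightarrow> reduced n w \<and> sink_word n Q w"
proof -
  have "(\<forall>k < length w. sink n (fold (reflect_quiver n) (take k w) Q) (w ! k)) \<longleftrightarrow> sink_word n Q w"
    by (induction w arbitrary: Q) (simp_all add: All_less_Suc2)
  then show ?thesis by (simp add: adapted_def)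
qed

lemma sink_word_append:
  "sink_word n Q (u @ v) \<longleftrightarrow> sink_word n Q u \<and> sink_word n (fold (reflect_quiver n) u Q) v"
  by (induction u arbitrary: Q) simp_all

lemma sink_word_twisted_quivers:
  "n \<ge> 3 \<Longrightarrow> Q \<in> twisted_quivers n \<Longrightarrow> sink_word n Q w \<Longrightarrow>
    fold (reflect_quiver n) w Q \<in> twisted_quivers n"
  by (induction w arbitrary: Q) (simp_all add: reflect_twisted_quivers)

text \<open>
  Two different sinks sit at non-adjacent vertices, so neither reflection disturbs the other;
  and a letter commuting with the sink that was just reflected must have been a sink already.
\<close>

lemma two_sinks:
  assumes n: "n \<ge> 3" and Q: "Q \<in> twisted_quivers n"
    and i: "sink n Q i" and j: "sink n Q j" and "i \<noteq> j"
  shows "cartan n i j = 0" and "sink n (reflect_quiver n i Q) j"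
    and "reflect_quiver n i (reflect_quiver n j Q) = reflect_quiver n j (reflect_quiver n i Q)"
proof -
  note i' = i[unfolded sink_iff[OF n Q]] and j' = j[unfolded sink_iff[OF n Q]]
  have adj: "\<not> line_adj n (vertex n i) (vertex n j)"
    using i' j' arrow_reverse[OF Q] line_adj_sym by blast
  then show "cartan n i j = 0" using i' j' \<open>i \<noteq> j\<close> cartan_zero_iff[OF n] by blast
  have v: "vertex n i \<noteq> vertex n j"
    using i' j' \<open>i \<noteq> j\<close> by (auto simp: vertex_def index_set_def min_def split: if_splits)
  then have "i < n \<or> j < n" by (auto simp: vertex_def)
  have sink: "sink n (reflect_quiver n i Q) j" if "sink n Q i" "sink n Q j"
      "vertex n i \<noteq> vertex n j" "i < n \<or> j < n" "\<not> line_adj n (vertex n i) (vertex n j)" for i j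
  proof -
    have "line_adj n q (vertex n j) \<Longrightarrow> q \<noteq> vertex n i" for q using that(5) by blast
    moreover have "n \<le> j \<Longrightarrow> i < n" using that(4) by simp
    ultimately show ?thesis
      using that(2,3) unfolding sink_iff[OF n Q] sink_iff[OF n reflect_twisted_quivers[OF n Q that(1)]]
      unfolding reflect_sink[OF n that(1)] twisted_quiver.sel by (simp add: reverse_at_iff)
  qed
  show ji: "sink n (reflect_quiver n i Q) j" using sink[OF i j v] \<open>i < n \<or> j < n\<close> adj by blast
  have ij: "sink n (reflect_quiver n j Q) i"
    using sink[OF j i] v \<open>i < n \<or> j < n\<close> adj line_adj_sym by metis
  show "reflect_quiver n i (reflect_quiver n j Q) = reflect_quiver n j (reflect_quiver n i Q)"
    unfolding reflect_sink[OF n ij] reflect_sink[OF n ji]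
    unfolding reflect_sink[OF n i] reflect_sink[OF n j] twisted_quiver.sel
    using \<open>i < n \<or> j < n\<close> by (simp add: reverse_at_commute)
qed

lemma sink_before_reflection:
  assumes n: "n \<ge> 3" and Q: "Q \<in> twisted_quivers n"
    and i: "sink n Q i" and j: "sink n (reflect_quiver n i Q) j" and ij: "cartan n i j = 0"
  shows "sink n Q j"
proof -
  let ?p = "vertex n i" and ?q = "vertex n j"
  note i' = i[unfolded sink_iff[OF n Q]]
  note j' = j[unfolded sink_iff[OF n reflect_twisted_quivers[OF n Q i]],
      unfolded reflect_sink[OF n i] twisted_quiver.sel]
  have adj: "i \<noteq> j" "\<not> line_adj n ?p ?q" using ij i' j' cartan_zero_iff[OF n] by auto
  have "?p \<in> {1..n}" using i' vertex_range n by auto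
  then obtain q where q: "line_adj n q ?p" using ex_line_adj[OF n] by blast
  have "?p \<noteq> ?q"
  proof
    assume "?p = ?q"
    then have "(q, ?p) \<in> reverse_at ?p (arrows Q)" using j' q by auto
    then have "(?p, q) \<in> arrows Q" by (simp add: reverse_at_iff)
    then show False using i' q arrow_reverse[OF Q] by blast
  qed
  then have "i < n \<or> j < n" by (auto simp: vertex_def)
  then have "n \<le> j \<Longrightarrow> i < n" by simp
  moreover have "line_adj n q ?q \<Longrightarrow> q \<noteq> ?p" for q using adj by blast
  ultimately show ?thesis using j' \<open>?p \<noteq> ?q\<close>
    unfolding sink_iff[OF n Q] twisted_quiver.sel by (simp add: reverse_at_iff)
qed

lemma sink_word_swap:
  assumes n: "n \<ge> 3" and Q: "Q \<in> twisted_quivers n"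
    and ij: "cartan n i j = 0" and w: "sink_word n Q (i # j # w)"
  shows "sink_word n Q (j # i # w)"
proof -
  have i: "sink n Q i" using w by simp
  have j: "sink n Q j" using sink_before_reflection[OF n Q i _ ij] w by simp
  show ?thesis using two_sinks[OF n Q j i] cartan_zero_imp_neq[OF ij] w i j by simp
qed

lemma sink_word_comm_eq:
  assumes n: "n \<ge> 3" and Q: "Q \<in> twisted_quivers n" and "comm_eq n u v" and u: "sink_word n Q u"
  shows "sink_word n Q v"
  using assms(3)
proof (induction rule: rtranclp_induct)
  case (step v v')
  then obtain xs ys i j where ij: "cartan n i j = 0" and v: "v = xs @ [i, j] @ ys"
    and v': "v' = xs @ [j, i] @ ys"
    unfolding comm_step_def by blast
  let ?Q = "fold (reflect_quiver n) xs Q"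
  have "sink_word n Q xs" "sink_word n ?Q (i # j # ys)" using step.IH v by (simp_all add: sink_word_append)
  moreover from this have "sink_word n ?Q (j # i # ys)"
    using sink_word_swap[OF n sink_word_twisted_quivers[OF n Q] ij] by blast
  ultimately show ?case using v' by (simp add: sink_word_append)
qed (rule u)

text \<open>
  A sink stays a sink until its own letter is played, and meanwhile only letters commuting with
  it can be played.
\<close>

lemma sink_persists:
  assumes n: "n \<ge> 3"
  shows "Q \<in> twisted_quivers n \<Longrightarrow> sink n Q i \<Longrightarrow> sink_word n Q x \<Longrightarrow> i \<notin> set x \<Longrightarrow> j \<in> set x \<Longrightarrow>
    cartan n j i = 0"
proof (induction x arbitrary: Q)
  case (Cons k x)
  have "sink n (reflect_quiver n k Q) i" using Cons.prems two_sinks[OF n Cons.prems(1), of k i] by auto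
  then have "j \<in> set x \<Longrightarrow> ?case"
    using Cons.prems reflect_twisted_quivers[OF n Cons.prems(1)] by (intro Cons.IH[of "reflect_quiver n k Q"]) simp_all
  then show ?case using Cons.prems two_sinks[OF n Cons.prems(1), of k i] by auto
qed simp

text \<open>
  The first letter of one word is a sink, so in the other word it commutes with everything that
  precedes its first occurrence and can be pulled to the front; then both words lose it.
\<close>

lemma sink_words_comm_eq:
  assumes n: "n \<ge> 3"
  shows "Q \<in> twisted_quivers n \<Longrightarrow> sink_word n Q u \<Longrightarrow> sink_word n Q v \<Longrightarrow> mset u = mset v \<Longrightarrow>
    comm_eq n u v"
proof (induction u arbitrary: Q v)
  case (Cons i u)
  have i: "sink n Q i" using Cons.prems by simp
  have "i \<in> set v" using Cons.prems(4) by (metis list.set_intros(1) mset_eq_setD)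
  then obtain x y where v: "v = x @ i # y" "i \<notin> set x" by (meson split_list_first)
  then have "cartan n j i = 0" if "j \<in> set x" for j
    using that v Cons.prems(3) sink_persists[OF n Cons.prems(1) i, of x j]
    by (simp add: sink_word_append)
  then have front: "comm_eq n v (i # x @ y)" using v(1) comm_eq_move_to_front by blast
  then have "sink_word n Q (i # x @ y)" using Cons.prems sink_word_comm_eq[OF n] by blast
  then have "comm_eq n u (x @ y)"
    using Cons.prems v(1) reflect_twisted_quivers[OF n Cons.prems(1) i]
    by (intro Cons.IH[of "reflect_quiver n i Q"]) auto
  then have "comm_eq n (i # u) (i # x @ y)" by (rule comm_eq_Cons)
  then show ?case using comm_eq_sym[OF front] by (rule rtranclp_trans)
qed simp

section \<open>The quiver of a word\<close>

definition first_pos :: "'a list \<Rightarrow> 'a \<Rightarrow> nat" where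
  "first_pos l a = length (takeWhile (\<lambda>b. b \<noteq> a) l)"

lemma first_pos_Cons [simp]: "first_pos (b # l) a = (if a = b then 0 else Suc (first_pos l a))"
  by (simp add: first_pos_def)

lemma first_pos_append:
  "first_pos (l @ m) a = (if a \<in> set l then first_pos l a else length l + first_pos m a)"
  by (induction l) auto

lemma first_pos_less: "a \<in> set l \<Longrightarrow> first_pos l a < length l"
  by (induction l) auto

lemma first_pos_inj: "a \<in> set l \<Longrightarrow> first_pos l a = first_pos l b \<Longrightarrow> a = b"
  by (induction l) (auto split: if_splits)

definition covers :: "nat \<Rightarrow> nat list \<Rightarrow> bool" where
  "covers n w \<longleftrightarrow> {1..n} \<subseteq> vertex n ` set w"

lemma coversD: "covers n w \<Longrightarrow> 1 \<le> p \<Longrightarrow> p \<le> n \<Longrightarrow> p \<in> vertex n ` set w"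
  unfolding covers_def by (erule subsetD) (rule atLeastAtMost_iff[THEN iffD2], simp)

text \<open>
  The only quiver of which a word that plays every vertex can be a sink sequence: arrows point to
  the vertex that is played first, and the type allows the first letter that plays the last vertex.
\<close>

definition quiver_of :: "nat \<Rightarrow> nat list \<Rightarrow> twisted_quiver" where
  "quiver_of n w = Twisted_Quiver
    {(a, b). line_adj n a b \<and> first_pos (map (vertex n) w) b < first_pos (map (vertex n) w) a}
    (if hd (filter (\<lambda>i. n \<le> i) w) = n then Odot else Otimes)"

lemma quiver_of_twisted_quivers:
  assumes "covers n w"
  shows "quiver_of n w \<in> twisted_quivers n"
proof -
  let ?f = "first_pos (map (vertex n) w)"
  have "?f b < ?f a \<longleftrightarrow> \<not> ?f a < ?f b" if "line_adj n a b" for a b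
  proof -
    have "a \<in> set (map (vertex n) w)" "a \<noteq> b"
      using that assms by (auto simp: line_adj_def covers_def)
    then show ?thesis using first_pos_inj by (metis linorder_neqE_nat not_less_iff_gr_or_eq)
  qed
  then show ?thesis using line_adj_sym
    unfolding quiver_of_def twisted_quivers_iff twisted_quiver.sel by blast
qed

text \<open>
  Before either of two adjacent vertices has been played, the arrow between them is untouched,
  so it must point to the one that is played first.
\<close>

lemma sink_word_arrow:
  assumes n: "n \<ge> 3" and p: "1 \<le> p" "p < n"
  shows "Q \<in> twisted_quivers n \<Longrightarrow> sink_word n Q w \<Longrightarrow> p \<in> vertex n ` set w \<Longrightarrow>
    (p, p + 1) \<in> arrows Q \<longleftrightarrow> first_pos (map (vertex n) w) (p + 1) < first_pos (map (vertex n) w) p"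
proof (induction w arbitrary: Q)
  case (Cons i w)
  have adj: "line_adj n p (p + 1)" using p by (simp add: line_adj_def)
  have i: "sink n Q i" using Cons.prems by simp
  note i' = i[unfolded sink_iff[OF n Cons.prems(1)]]
  consider "vertex n i = p" | "vertex n i = p + 1" | "vertex n i \<noteq> p" "vertex n i \<noteq> p + 1" by blast
  then show ?case
  proof cases
    case 1
    then have "(p + 1, p) \<in> arrows Q" using i' adj line_adj_sym by blast
    then show ?thesis using 1 arrow_reverse[OF Cons.prems(1) adj] by simp
  next
    case 2
    then have "(p, p + 1) \<in> arrows Q" using i' adj by simp
    then show ?thesis using 2 by simp
  next
    case 3
    let ?Q = "reflect_quiver n i Q"
    have "(p, p + 1) \<in> arrows Q \<longleftrightarrow> (p, p + 1) \<in> arrows ?Q"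
      using 3 by (simp add: reflect_sink[OF n i] reverse_at_iff)
    also have "\<dots> \<longleftrightarrow> first_pos (map (vertex n) w) (p + 1) < first_pos (map (vertex n) w) p"
      using 3 Cons.prems reflect_twisted_quivers[OF n Cons.prems(1) i] by (intro Cons.IH) auto
    finally show ?thesis using 3 by simp
  qed
qed simp

text \<open>
  The type changes only when the last vertex is played, and the letter that does this for the first
  time must be the one allowed by the original type.
\<close>

lemma sink_word_type:
  assumes n: "n \<ge> 3"
  shows "Q \<in> twisted_quivers n \<Longrightarrow> sink_word n Q w \<Longrightarrow> n \<in> vertex n ` set w \<Longrightarrow>
    last_type Q = (if hd (filter (\<lambda>i. n \<le> i) w) = n then Odot else Otimes)"
proof (induction w arbitrary: Q)
  case (Cons i w)
  have i: "sink n Q i" using Cons.prems by simp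
  show ?case
  proof (cases "n \<le> i")
    case True
    then show ?thesis using i[unfolded sink_iff[OF n Cons.prems(1)]] by (cases "last_type Q") auto
  next
    case False
    have "last_type (reflect_quiver n i Q) = (if hd (filter (\<lambda>i. n \<le> i) w) = n then Odot else Otimes)"
      using False Cons.prems reflect_twisted_quivers[OF n Cons.prems(1) i]
      by (intro Cons.IH) (auto simp: vertex_def)
    then show ?thesis using False by (simp add: reflect_sink[OF n i])
  qed
qed simp

lemma sink_word_quiver_of:
  assumes "n \<ge> 3" "Q \<in> twisted_quivers n" "sink_word n Q w" "covers n w"
  shows "Q = quiver_of n w"
proof (rule twisted_quiver_eqI[OF assms(2) quiver_of_twisted_quivers[OF assms(4)]])
  show "last_type Q = last_type (quiver_of n w)"
    using sink_word_type[OF assms(1-3)] coversD[OF assms(4), of n] assms(1)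
    by (simp add: quiver_of_def)
  fix p assume p: "1 \<le> p" "p < n"
  then show "(p, p + 1) \<in> arrows Q \<longleftrightarrow> (p, p + 1) \<in> arrows (quiver_of n w)"
    using sink_word_arrow[OF assms(1) p assms(2,3)] coversD[OF assms(4), of p]
    by (auto simp: quiver_of_def line_adj_def)
qed

section \<open>Rotating Coxeter words\<close>

lemma coxeter_wordD:
  assumes "n \<ge> 3" "coxeter_word n w"
  shows "distinct (map (vertex n) w)" "vertex n ` set w = {1..n}" "set w \<subseteq> index_set n" "length w = n"
    "distinct w" "covers n w"
proof -
  have c: "set w \<subseteq> index_set n" "mset (map (vertex n) w) = mset [1..<n + 1]"
    using assms by (simp_all only: coxeter_word_iff)
  show "distinct (map (vertex n) w)" using c(2) by (metis distinct_upt mset_eq_imp_distinct_iff)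
  then show "distinct w" by (simp add: distinct_map)
  show v: "vertex n ` set w = {1..n}"
    using mset_eq_setD[OF c(2)] by (simp add: atLeastLessThanSuc_atLeastAtMost del: upt_Suc)
  show "length w = n" using assms(2) by (simp add: coxeter_word_def)
  show "covers n w" using v by (simp add: covers_def)
qed (use assms coxeter_word_iff in blast)

lemma coxeter_word_mset_cong:
  "n \<ge> 3 \<Longrightarrow> mset u = mset v \<Longrightarrow> coxeter_word n u \<longleftrightarrow> coxeter_word n v"
  by (simp add: coxeter_word_iff del: upt_Suc) (metis set_mset_mset)

lemma coxeter_word_comm_eq:
  "n \<ge> 3 \<Longrightarrow> comm_eq n u v \<Longrightarrow> coxeter_word n u \<longleftrightarrow> coxeter_word n v"
  using coxeter_word_mset_cong comm_eq_mset by blast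

lemma coxeter_word_map_vee:
  assumes "n \<ge> 3"
  shows "coxeter_word n (x @ map (vee n) y) \<longleftrightarrow> coxeter_word n (x @ y)"
  using assms by (auto simp: coxeter_word_iff comp_def image_subset_iff simp del: upt_Suc)

lemma coxeter_word_rotate:
  assumes "n \<ge> 3"
  shows "coxeter_word n (y @ map (vee n) x) \<longleftrightarrow> coxeter_word n (x @ y)"
  using coxeter_word_map_vee[OF assms] coxeter_word_mset_cong[OF assms, of "y @ x" "x @ y"]
  by (simp add: union_commute)

text \<open>
  Reflecting the quiver of a Coxeter word at its first letter moves this letter, twisted, to the
  end of the word: the vertex now comes after both its neighbours, and the type of the last
  vertex changes exactly when that vertex was played.
\<close>

lemma reflect_quiver_of:
  assumes n: "n \<ge> 3" and c: "coxeter_word n (i # u)"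
  shows "sink n (quiver_of n (i # u)) i"
    and "reflect_quiver n i (quiver_of n (i # u)) = quiver_of n (u @ [vee n i])"
proof -
  note d = coxeter_wordD[OF n c]
  let ?Q = "quiver_of n (i # u)" and ?p = "vertex n i" and ?l = "map (vertex n) u"
  have p: "?p \<notin> set ?l" and l: "insert ?p (set ?l) = {1..n}" using d(1,2) by auto
  have i: "i \<in> index_set n" using d(3) by simp
  have Q: "?Q \<in> twisted_quivers n" using quiver_of_twisted_quivers d(6) by blast
  show s: "sink n ?Q i"
    unfolding sink_iff[OF n Q] using i p by (auto simp: quiver_of_def line_adj_def)
  have "reverse_at ?p (arrows ?Q) = arrows (quiver_of n (u @ [vee n i]))"
  proof (intro set_eqI, clarify)
    fix a b
    show "(a, b) \<in> reverse_at ?p (arrows ?Q) \<longleftrightarrow> (a, b) \<in> arrows (quiver_of n (u @ [vee n i]))"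
    proof (cases "line_adj n a b")
      case True
      then have "a \<noteq> b" "a \<in> insert ?p (set ?l)" "b \<in> insert ?p (set ?l)"
        unfolding l by (auto simp: line_adj_def)
      then show ?thesis using True p first_pos_less[of a ?l] first_pos_less[of b ?l] line_adj_sym[of n a b]
        by (auto simp: reverse_at_iff quiver_of_def first_pos_append simp del: set_map)
    next
      case False
      then show ?thesis using line_adj_sym[of n a b] by (auto simp: reverse_at_iff quiver_of_def)
    qed
  qed
  moreover have "last_type (quiver_of n (u @ [vee n i])) =
      (if i < n then last_type ?Q else switch_type (last_type ?Q))"
  proof (cases "i < n")
    case False
    then have "filter (\<lambda>i. n \<le> i) u = []"
      using p by (force simp: filter_empty_conv vertex_def)
    then show ?thesis using False i by (auto simp: quiver_of_def vee_def index_set_def)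
  qed (simp add: quiver_of_def)
  ultimately show "reflect_quiver n i ?Q = quiver_of n (u @ [vee n i])"
    unfolding reflect_sink[OF n s] by (intro twisted_quiver.expand) simp
qed

lemma coxeter_sink_word_prefix:
  assumes n: "n \<ge> 3"
  shows "coxeter_word n (x @ y) \<Longrightarrow> sink_word n (quiver_of n (x @ y)) x \<and>
    fold (reflect_quiver n) x (quiver_of n (x @ y)) = quiver_of n (y @ map (vee n) x)"
proof (induction x arbitrary: y)
  case (Cons i x)
  have "coxeter_word n (x @ (y @ [vee n i]))"
    using Cons.prems coxeter_word_rotate[OF n, of "x @ y" "[i]"] by simp
  from Cons.IH[OF this] show ?case using reflect_quiver_of[OF n, of i "x @ y"] Cons.prems by simp
qed simp

text \<open>
  The first \<open>m\<close> of the \<open>n + 1\<close> blocks of the twisted word, for inductions on the number of blocks.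
\<close>

definition twisted_power :: "nat \<Rightarrow> nat \<Rightarrow> nat list \<Rightarrow> nat list" where
  "twisted_power n m w = concat (map (\<lambda>k. map (vee n ^^ k) w) [0..<m])"

lemma twisted_power_simps [simp]:
  "twisted_power n 0 w = []"
  "twisted_power n (Suc m) w = twisted_power n m w @ map (vee n ^^ m) w"
  by (simp_all add: twisted_power_def)

lemma twisted_word_eq: "twisted_word n w = twisted_power n (n + 1) w"
  by (simp add: twisted_word_def twisted_power_def)

lemma coxeter_word_map_vee_power:
  assumes "n \<ge> 3"
  shows "coxeter_word n (map (vee n ^^ k) w) \<longleftrightarrow> coxeter_word n w"
proof (induction k)
  case (Suc k)
  have "map (vee n ^^ Suc k) w = [] @ map (vee n) (map (vee n ^^ k) w)" by simp
  then show ?case using coxeter_word_map_vee[OF assms, of "[]"] Suc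
    by (simp only: append_Nil)
qed simp

lemma coxeter_sink_word_power:
  assumes n: "n \<ge> 3" and c: "coxeter_word n w"
  shows "sink_word n (quiver_of n w) (twisted_power n m w) \<and>
    fold (reflect_quiver n) (twisted_power n m w) (quiver_of n w) = quiver_of n (map (vee n ^^ m) w)"
proof (induction m)
  case (Suc m)
  have "coxeter_word n (map (vee n ^^ m) w @ [])"
    using c coxeter_word_map_vee_power[OF n] by simp
  from coxeter_sink_word_prefix[OF n this] Suc show ?case by (simp add: sink_word_append comp_def)
qed simp

lemma coxeter_sink_word:
  assumes "n \<ge> 3" "coxeter_word n w"
  shows "sink_word n (quiver_of n w) w" "sink_word n (quiver_of n w) (twisted_word n w)"
  using coxeter_sink_word_power[OF assms, of 1] coxeter_sink_word_power[OF assms, of "n + 1"]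
  by (simp_all add: twisted_word_eq)

text \<open>
  Two sink sequences of the same quiver; they have the same letters because the type of the quiver
  tells which of \<open>n\<close> and \<open>n + 1\<close> occurs.
\<close>

lemma coxeter_same_quiver:
  assumes n: "n \<ge> 3" and c: "coxeter_word n u" "coxeter_word n v"
    and Q: "quiver_of n u = quiver_of n v"
  shows "comm_eq n u v"
proof (rule sink_words_comm_eq[OF n])
  show "quiver_of n u \<in> twisted_quivers n"
    using quiver_of_twisted_quivers coxeter_wordD[OF n c(1)] by blast
  show "sink_word n (quiver_of n u) u" "sink_word n (quiver_of n u) v"
    using coxeter_sink_word(1)[OF n c(1)] coxeter_sink_word(1)[OF n c(2)] Q by simp_all
  have last: "filter (\<lambda>i. n \<le> i) w = [if last_type (quiver_of n w) = Odot then n else n + 1]"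
    if w: "coxeter_word n w" for w
  proof -
    note d = coxeter_wordD[OF n w]
    let ?f = "filter (\<lambda>i. n \<le> i) w"
    have "n \<in> vertex n ` set w" using d(2) n by simp
    then have "?f \<noteq> []" by (force simp: filter_empty_conv vertex_def)
    moreover have v: "\<forall>i \<in> set ?f. vertex n i = n" by (simp add: vertex_def)
    have "distinct (map (vertex n) ?f)" using d(1) by (simp add: distinct_map_filter)
    then have "length ?f \<le> 1" using v by (cases ?f rule: remdups_adj.cases) auto
    ultimately obtain i where i: "?f = [i]" by (cases ?f rule: remdups_adj.cases) auto
    then have "i \<in> set ?f" by simp
    then have "i = n \<or> i = n + 1" using d(3) by (auto simp: index_set_def)
    then show ?thesis using i by (auto simp: quiver_of_def)
  qed
  have rest: "mset (filter (\<lambda>i. \<not> n \<le> i) w) = mset [1..<n]" if w: "coxeter_word n w" for w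
  proof -
    have "map (vertex n) (filter (\<lambda>i. \<not> n \<le> i) w) = filter (\<lambda>p. \<not> n \<le> p) (map (vertex n) w)"
      by (induction w) (auto simp: vertex_def)
    moreover have "map (vertex n) (filter (\<lambda>i. \<not> n \<le> i) w) = filter (\<lambda>i. \<not> n \<le> i) w"
      by (intro map_idI) (simp add: vertex_def)
    ultimately have "mset (filter (\<lambda>i. \<not> n \<le> i) w) = filter_mset (\<lambda>p. \<not> n \<le> p) (mset [1..<n + 1])"
      using w unfolding coxeter_word_iff[OF n] by (metis mset_filter)
    also have "[1..<n + 1] = [1..<n] @ [n]" using n by simp
    also have "filter_mset (\<lambda>p. \<not> n \<le> p) (mset ([1..<n] @ [n])) =
        mset (filter (\<lambda>p. \<not> n \<le> p) ([1..<n] @ [n]))" by (rule mset_filter[symmetric])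
    also have "filter (\<lambda>p. \<not> n \<le> p) ([1..<n] @ [n]) = [1..<n]"
      unfolding filter_append by (subst filter_True) auto
    finally show ?thesis .
  qed
  have "mset w = mset (filter (\<lambda>i. n \<le> i) w) + mset (filter (\<lambda>i. \<not> n \<le> i) w)" for w
    by (simp add: multiset_partition[symmetric])
  then show "mset u = mset v" using last[OF c(1)] last[OF c(2)] rest[OF c(1)] rest[OF c(2)] Q by metis
qed

text \<open>
  The vertices are ordered one after the other: among the first \<open>k + 1\<close> vertices the last one is
  adjacent to \<open>k\<close> only, so it can be put in front of or behind all others, as its arrow demands.
\<close>

lemma ex_coxeter_word_quiver:
  assumes n: "n \<ge> 3" and Q: "Q \<in> twisted_quivers n"
  obtains w where "coxeter_word n w" "quiver_of n w = Q"
proof -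
  have "\<exists>l. distinct l \<and> set l = {1..k} \<and>
      (\<forall>p. 1 \<le> p \<and> p < k \<longrightarrow> (first_pos l (p + 1) < first_pos l p \<longleftrightarrow> (p, p + 1) \<in> arrows Q))" for k
  proof (induction k)
    case 0 show ?case by (intro exI[of _ "[]"]) simp
  next
    case (Suc k)
    then obtain l where l: "distinct l" "set l = {1..k}"
        "\<And>p. 1 \<le> p \<Longrightarrow> p < k \<Longrightarrow> first_pos l (p + 1) < first_pos l p \<longleftrightarrow> (p, p + 1) \<in> arrows Q"
      by blast
    let ?l = "if (k, k + 1) \<in> arrows Q then (k + 1) # l else l @ [k + 1]"
    have "first_pos ?l (p + 1) < first_pos ?l p \<longleftrightarrow> (p, p + 1) \<in> arrows Q"
      if "1 \<le> p" "p < Suc k" for p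
    proof (cases "p = k")
      case True
      then show ?thesis using that l(2) first_pos_less[of k l] by (auto simp: first_pos_append)
    next
      case False
      then show ?thesis using that l(2) l(3)[of p] by (auto simp: first_pos_append)
    qed
    then show ?case using l by (intro exI[of _ ?l]) auto
  qed
  from this[of n] obtain l where l: "distinct l" "set l = {1..n}"
      "\<And>p. 1 \<le> p \<Longrightarrow> p < n \<Longrightarrow> first_pos l (p + 1) < first_pos l p \<longleftrightarrow> (p, p + 1) \<in> arrows Q"
    by blast
  let ?f = "\<lambda>p. if p = n \<and> last_type Q = Otimes then n + 1 else p"
  let ?w = "map ?f l"
  have vl: "map (vertex n) ?w = l"
    using l(2) by (auto simp: vertex_def intro!: map_idI)
  have "set l = set [1..<n + 1]"
    unfolding l(2) by (simp add: atLeastLessThanSuc_atLeastAtMost del: upt_Suc)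
  then have "mset l = mset [1..<n + 1]"
    by (rule set_eq_iff_mset_eq_distinct[OF l(1) distinct_upt, THEN iffD1])
  then have c: "coxeter_word n ?w"
    unfolding coxeter_word_iff[OF n] vl using l(2) by (auto simp: index_set_def simp del: upt_Suc)
  have "Q = quiver_of n ?w"
  proof (rule twisted_quiver_eqI[OF Q quiver_of_twisted_quivers])
    show "covers n ?w" using coxeter_wordD[OF n c] by blast
    let ?v = "filter (\<lambda>i. n \<le> i) ?w"
    have "n \<in> set l" using l(2) n by simp
    then have "?f n \<in> ?f ` set l" by (rule imageI)
    moreover have "n \<le> ?f n" by simp
    ultimately have "?f n \<in> set ?v" by (simp only: set_filter set_map mem_Collect_eq)
    then have "?v \<noteq> []" by (rule length_pos_if_in_set[THEN length_greater_0_conv[THEN iffD1]])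
    then have "hd ?v \<in> set ?v" by (rule hd_in_set)
    then have hd: "hd ?v \<in> ?f ` set l" "n \<le> hd ?v"
      by (simp_all only: set_filter set_map mem_Collect_eq)
    from hd(1) obtain p where p: "hd ?v = ?f p" "p \<in> set l" by (rule imageE)
    have "p \<le> n" using p(2) l(2) by simp
    moreover have "n \<le> ?f p" using hd(2) unfolding p(1) .
    ultimately have "p = n" by (simp split: if_splits)
    with p(1) have "hd ?v = ?f n" by (simp only:)
    then show "last_type Q = last_type (quiver_of n ?w)"
      by (cases "last_type Q") (simp_all add: quiver_of_def)
    show "(p, p + 1) \<in> arrows Q \<longleftrightarrow> (p, p + 1) \<in> arrows (quiver_of n ?w)" if "1 \<le> p" "p < n" for p
      using that l(3)[of p] vl by (simp add: quiver_of_def line_adj_def)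
  qed
  then show ?thesis by (rule that[OF c sym])
qed

text \<open>
  Properties are transported backwards along rotations of words because this is the direction in
  which both applications, the orbit of classes and powers of twisted Coxeter elements, need it.
\<close>

lemma coxeter_rotate_block:
  assumes n: "n \<ge> 3" and rot: "\<And>i a. coxeter_word n (i # a) \<Longrightarrow> P (a @ [vee n i]) \<Longrightarrow> P (i # a)"
  shows "coxeter_word n (x @ y) \<Longrightarrow> P (y @ map (vee n) x) \<Longrightarrow> P (x @ y)"
proof (induction x arbitrary: y)
  case (Cons i x)
  have "coxeter_word n (x @ (y @ [vee n i]))"
    using Cons.prems(1) coxeter_word_rotate[OF n, of "x @ y" "[i]"] by simp
  then have "P (x @ (y @ [vee n i]))" using Cons.prems(2) by (intro Cons.IH) simp_all
  then show ?case using rot[of i "x @ y"] Cons.prems(1) by simp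
qed simp

lemma coxeter_word_upt: "n \<ge> 3 \<Longrightarrow> coxeter_word n [1..<n + 1]"
proof -
  assume n: "n \<ge> 3"
  have "map (vertex n) [1..<n + 1] = [1..<n + 1]" by (intro map_idI) (auto simp: vertex_def)
  then show ?thesis
    unfolding coxeter_word_iff[OF n] by (auto simp: index_set_def simp del: upt_Suc)
qed

text \<open>
  A Coxeter word \<open>U X (k + 1) Y\<close> with \<open>U = 1 \<dots> k\<close> can be rotated, up to commutations, into one that
  starts with \<open>1 \<dots> k (k + 1)\<close>, because \<open>U\<close> commutes with \<open>X\<close> and \<open>Y\<close>: rotate \<open>U X\<close>, then the letter
  \<open>k + 1\<close>, then \<open>Y\<close> and the twisted \<open>X\<close>.  Hence a property that can be transported backwards
  along rotations has to be checked on \<open>1 \<dots> n\<close> only.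
\<close>

lemma coxeter_word_induct [consumes 2, case_names base comm rot]:
  assumes n: "n \<ge> 3" and w: "coxeter_word n w"
    and base: "P [1..<n + 1]"
    and comm: "\<And>u v. coxeter_word n u \<Longrightarrow> comm_eq n u v \<Longrightarrow> P u \<Longrightarrow> P v"
    and rot: "\<And>i a. coxeter_word n (i # a) \<Longrightarrow> P (a @ [vee n i]) \<Longrightarrow> P (i # a)"
  shows "P w"
proof -
  have block: "P (x @ y)" if "coxeter_word n (x @ y)" "P (y @ map (vee n) x)" for x y
    by (rule coxeter_rotate_block[where P = P, OF n _ that]) (rule rot)
  have vee_init: "map (vee n) [1..<k] = [1..<k]" if "k \<le> n" for k
    using that by (intro map_idI) simp
  have "\<forall>A. coxeter_word n ([1..<k + 1] @ A) \<longrightarrow> P ([1..<k + 1] @ A)" if "k \<le> n - 1" for k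
    using that
  proof (induction k rule: inc_induct)
    case base
    have n1: "n - 1 + 1 = n" using n by simp
    show ?case unfolding n1
    proof (intro allI impI)
      fix A assume c: "coxeter_word n ([1..<n] @ A)"
      note d = coxeter_wordD[OF n c]
      have "length A = Suc 0" using d(4) n by simp
      then obtain v where A: "A = [v]" by (auto simp: length_Suc_conv)
      have "map (vertex n) [1..<n] = [1..<n]" by (intro map_idI) (simp add: vertex_def)
      then have "vertex n v \<notin> set [1..<n]" using d(1) A by (simp del: set_upt set_map)
      moreover have "vertex n v \<in> {1..n}" using d(3) A n vertex_range[of v n] by simp
      ultimately have "v = n \<or> v = n + 1" using d(3) A by (auto simp: vertex_def index_set_def)
      then show "P ([1..<n] @ A)"
      proof
        assume "v = n"
        then show ?thesis using \<open>P [1..<n + 1]\<close> A n by simp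
      next
        assume v: "v = n + 1"
        then have "map (vee n) ([1..<n] @ A) = [1..<n + 1]"
          using vee_init[of n] A n by (simp add: vee_def[of n "Suc n"])
        then have "P ([] @ map (vee n) ([1..<n] @ A))" using \<open>P [1..<n + 1]\<close> by simp
        moreover have "coxeter_word n (([1..<n] @ A) @ [])" using c by simp
        ultimately have "P (([1..<n] @ A) @ [])" by (rule block[rotated])
        then show ?thesis by simp
      qed
    qed
  next
    case (step k)
    show ?case
    proof (intro allI impI)
      fix A assume c: "coxeter_word n ([1..<k + 1] @ A)"
      let ?U = "[1..<k + 1]" and ?v = "map (vee n)"
      note upt_Suc [simp del]
      note d = coxeter_wordD[OF n c]
      have k: "k + 1 < n" using step.hyps by simp
      have vU: "map (vertex n) ?U = ?U" using k by (intro map_idI) (auto simp: vertex_def)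
      have veeU: "?v ?U = ?U" using vee_init k by simp
      have "k + 1 \<in> vertex n ` set (?U @ A)" unfolding d(2) using k by simp
      then obtain z where z: "k + 1 = vertex n z" "z \<in> set (?U @ A)" by (rule imageE)
      then have "z = k + 1" using k by (auto simp: vertex_def)
      then have "k + 1 \<in> set A" using z(2) by simp
      then obtain X Y where A: "A = X @ (k + 1) # Y" by (meson split_list)
      have far: "cartan n j i = 0" "cartan n i j = 0"
        if "i \<in> set ?U" "j \<in> set (X @ Y) \<or> j \<in> set (?v (X @ Y))" for i j
      proof -
        have "j \<in> set (X @ Y) \<or> vee n j \<in> set (X @ Y)" using that(2) by auto
        then obtain j' where j': "j' \<in> set (X @ Y)" "j' = j \<or> j' = vee n j" by blast
        then have vj: "vertex n j = vertex n j'" by auto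
        have j'I: "j' \<in> index_set n" using j'(1) d(3) A by auto
        then have jI: "j \<in> index_set n" using j'(2) n by auto
        have "distinct (?U @ map (vertex n) A)" using d(1) unfolding map_append vU .
        then have "set ?U \<inter> (vertex n ` set X \<union> vertex n ` set Y) = {}"
            "vertex n (k + 1) \<notin> vertex n ` set X \<union> vertex n ` set Y"
          unfolding A by auto
        moreover have "vertex n j' \<in> vertex n ` set X \<union> vertex n ` set Y" using j'(1) by auto
        ultimately have "vertex n j' \<notin> set ?U" "vertex n j' \<noteq> vertex n (k + 1)" by (blast, metis)
        moreover have "vertex n j' \<ge> 1" using vertex_range[OF j'I] n by simp
        moreover have "vertex n (k + 1) = k + 1" using k by (simp add: vertex_def)
        ultimately have "vertex n j > k + 1" using vj by auto
        moreover have "vertex n i = i" "i \<le> k" "i \<in> index_set n"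
          using that(1) k by (auto simp: vertex_def index_set_def)
        ultimately show "cartan n j i = 0" "cartan n i j = 0"
          using cartan_zero_iff[OF n jI, of i] cartan_sym[of n i j] by (auto simp: line_adj_def)
      qed
      have c0: "coxeter_word n (?U @ X @ (k + 1) # Y)" using c A by simp
      then have c1: "coxeter_word n ((k + 1) # Y @ ?U @ ?v X)"
        using coxeter_word_rotate[OF n, of "(k + 1) # Y" "?U @ X"] veeU by simp
      have e1: "comm_eq n ((k + 1) # ?U @ Y @ ?v X) ((k + 1) # Y @ ?U @ ?v X)"
        using comm_eq_context[OF comm_eq_blocks[of ?U Y n], of "[k + 1]" "?v X"] far by simp
      have c2: "coxeter_word n ((k + 1) # ?U @ Y @ ?v X)"
        using c1 coxeter_word_comm_eq[OF n e1] by simp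
      have vk: "vee n (k + 1) = k + 1" using k by simp
      have c3: "coxeter_word n ((?U @ Y @ ?v X) @ [k + 1])"
        using coxeter_word_rotate[OF n, of "?U @ Y @ ?v X" "[k + 1]"] c2 vk by (simp del: vee_fixed)
      have "comm_eq n ((Y @ ?v X) @ ?U) (?U @ (Y @ ?v X))"
        using far by (intro comm_eq_blocks) auto
      from comm_eq_append2[OF this, of "[k + 1]"]
      have e2: "comm_eq n ((Y @ ?v X) @ (?U @ [k + 1])) ((?U @ Y @ ?v X) @ [k + 1])" by simp
      have c4: "coxeter_word n ((Y @ ?v X) @ (?U @ [k + 1]))"
        using coxeter_word_comm_eq[OF n e2] c3 by simp
      have c5: "coxeter_word n ((?U @ [k + 1]) @ ?v (Y @ ?v X))"
        using coxeter_word_rotate[OF n, of "?U @ [k + 1]" "Y @ ?v X"] c4 by blast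
      have "?U @ [k + 1] = [1..<Suc k + 1]" by (simp add: upt_Suc)
      then have "P ((?U @ [k + 1]) @ ?v (Y @ ?v X))" using step.IH c5 by metis
      then have "P ((Y @ ?v X) @ (?U @ [k + 1]))" by (rule block[OF c4])
      then have "P ((?U @ Y @ ?v X) @ [k + 1])" by (rule comm[OF c4 e2])
      then have "P ((k + 1) # ?U @ Y @ ?v X)" using rot[OF c2] vk by (simp del: vee_fixed)
      then have "P ((k + 1) # Y @ ?U @ ?v X)" by (rule comm[OF c2 e1])
      then have "P (((k + 1) # Y) @ ?v (?U @ X))" using veeU by simp
      moreover have "coxeter_word n ((?U @ X) @ (k + 1) # Y)" using c0 by simp
      ultimately have "P ((?U @ X) @ (k + 1) # Y)" by (rule block[rotated])
      then show "P (?U @ A)" using A by simp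
    qed
  qed
  from this[of 0] show ?thesis using w by simp
qed

text \<open>
  Consecutive blocks differ by \<open>vee\<close>, so the twisted letter at the end of a block of one word is the
  letter with which the next block of the other word begins.
\<close>

lemma twisted_power_rotate:
  "i # twisted_power n m (a @ [vee n i]) = twisted_power n m (i # a) @ [(vee n ^^ m) i]"
proof (induction m)
  case (Suc m)
  have "(vee n ^^ m) (vee n i) = (vee n ^^ Suc m) i" by (simp only: funpow_Suc_right comp_apply)
  then show ?case using Suc by simp
qed simp

lemma twisted_power_Suc_left: "twisted_power n (Suc m) w = w @ map (vee n) (twisted_power n m w)"
proof (induction m)
  case (Suc m)
  have "twisted_power n (Suc (Suc m)) w = twisted_power n (Suc m) w @ map (vee n ^^ Suc m) w"
    by (rule twisted_power_simps)
  also have "\<dots> = w @ map (vee n) (twisted_power n m w @ map (vee n ^^ m) w)" unfolding Suc by simp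
  also have "\<dots> = w @ map (vee n) (twisted_power n (Suc m) w)" by simp
  finally show ?case .
qed simp

lemma twisted_power_comm_eq:
  assumes "n \<ge> 3" "comm_eq n u v"
  shows "comm_eq n (twisted_power n m u) (twisted_power n m v)"
proof (induction m)
  case (Suc m)
  have "comm_eq n (twisted_power n m u @ map (vee n ^^ m) u) (twisted_power n m v @ map (vee n ^^ m) u)"
    by (rule comm_eq_append2[OF Suc])
  also have "comm_eq n (twisted_power n m v @ map (vee n ^^ m) u) (twisted_power n m v @ map (vee n ^^ m) v)"
    by (rule comm_eq_append1[OF comm_eq_map_vee_power[OF assms]])
  finally show ?case by simp
qed simp

lemma twisted_power_index:
  "n \<ge> 3 \<Longrightarrow> set w \<subseteq> index_set n \<Longrightarrow> set (twisted_power n m w) \<subseteq> index_set n"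
  by (induction m) auto

lemma length_twisted_power: "length (twisted_power n m w) = m * length w"
  by (induction m) simp_all

section \<open>Words without repeated letters\<close>

definition pairing :: "nat \<Rightarrow> nat \<Rightarrow> vec \<Rightarrow> int" where
  "pairing n i v = (\<Sum>k \<in> index_set n. cartan n i k * v k)"

lemma simple_refl_eq: "simple_refl n i v = v(i := v i - pairing n i v)"
  by (auto simp: simple_refl_def pairing_def simple_root_def)

lemma finite_index_set [simp]: "finite (index_set n)"
  by (simp add: index_set_def)

lemma pairing_update:
  "pairing n i (v(j := a)) = pairing n i v + (if j \<in> index_set n then cartan n i j * (a - v j) else 0)"
proof -
  have "pairing n i (v(j := a)) - pairing n i v =
      (\<Sum>k \<in> index_set n. if k = j then cartan n i j * (a - v j) else 0)"
    unfolding pairing_def sum_subtractf[symmetric]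
    by (intro sum.cong refl) (auto simp: algebra_simps)
  then show ?thesis by (simp add: sum.delta)
qed

lemma pairing_simple_root:
  assumes "i \<in> index_set n"
  shows "pairing n j (simple_root i) = cartan n j i"
proof -
  have "pairing n j (simple_root i) = (\<Sum>k \<in> index_set n. if k = i then cartan n j i else 0)"
    unfolding pairing_def simple_root_def by (intro sum.cong refl) auto
  then show ?thesis using assms by (simp add: sum.delta)
qed

lemma simple_refl_involution: "i \<in> index_set n \<Longrightarrow> simple_refl n i (simple_refl n i v) = v"
  by (auto simp: simple_refl_eq pairing_update cartan_def)

lemma simple_refl_commute:
  "cartan n i j = 0 \<Longrightarrow> simple_refl n i (simple_refl n j v) = simple_refl n j (simple_refl n i v)"
  using cartan_sym[of n i j] cartan_zero_imp_neq[of n i j]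
  by (auto simp: simple_refl_eq pairing_update)

lemma word_prod_simps [simp]:
  "word_prod n [] v = v"
  "word_prod n (i # w) v = simple_refl n i (word_prod n w v)"
  by (simp_all add: word_prod_def)

lemma word_prod_append [simp]: "word_prod n (u @ w) v = word_prod n u (word_prod n w v)"
  by (induction u) simp_all

lemma word_prod_comm_eq:
  assumes "comm_eq n u w"
  shows "word_prod n u = word_prod n w"
  using assms
proof (induction rule: rtranclp_induct)
  case (step w w')
  then obtain xs ys i j where "cartan n i j = 0" "w = xs @ [i, j] @ ys" "w' = xs @ [j, i] @ ys"
    unfolding comm_step_def by blast
  then have "word_prod n w v = word_prod n w' v" for v
    using simple_refl_commute[of n i j "word_prod n ys v"] by simp
  then have "word_prod n w = word_prod n w'" by (rule ext)
  with step.IH show ?case by simp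
qed simp

lemma word_prod_rev:
  "set w \<subseteq> index_set n \<Longrightarrow> word_prod n (rev w) (word_prod n w v) = v"
  by (induction w arbitrary: v) (simp_all add: simple_refl_involution)

lemma word_prod_rev':
  "set w \<subseteq> index_set n \<Longrightarrow> word_prod n w (word_prod n (rev w) v) = v"
  using word_prod_rev[of "rev w" n v] by simp

lemma word_prod_untouched: "j \<notin> set w \<Longrightarrow> word_prod n w v j = v j"
  by (induction w) (simp_all add: simple_refl_eq)

text \<open>
  If the letter \<open>j\<close> occurs exactly once in a word, the product sends some vector with coordinate
  1 at \<open>j\<close> to one with coordinate \<open>-1\<close> there; so every word for the same element uses \<open>j\<close>.
\<close>

lemma support_subset:
  assumes w: "distinct w" "set w \<subseteq> index_set n" and eq: "word_prod n w = word_prod n w'"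
  shows "set w \<subseteq> set w'"
proof
  fix j assume "j \<in> set w"
  then obtain x y where xy: "w = x @ j # y" by (meson split_list)
  then have j: "j \<notin> set x" "j \<notin> set y" "j \<in> index_set n" "set y \<subseteq> index_set n" using w by auto
  let ?v = "word_prod n (rev y) (simple_root j)"
  have "word_prod n w ?v j = simple_refl n j (simple_root j) j"
    using xy j by (simp add: word_prod_untouched word_prod_rev')
  also have "\<dots> = -1"
    using j by (simp add: simple_refl_eq pairing_simple_root cartan_def) (simp add: simple_root_def)
  finally have "word_prod n w' ?v j = -1" using eq by simp
  moreover have "?v j = 1" using j by (simp add: word_prod_untouched) (simp add: simple_root_def)
  ultimately show "j \<in> set w'" using word_prod_untouched[of j w' n ?v] by auto
qed

text \<open>
  Each letter acts on a coordinate that is still zero and adds to it the coordinates of its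
  neighbours, which are at most 0.
\<close>

lemma word_prod_nonpos:
  "distinct w \<Longrightarrow> (\<And>j. v j \<le> 0) \<Longrightarrow> (\<And>j. j \<in> set w \<Longrightarrow> v j = 0) \<Longrightarrow> word_prod n w v k \<le> 0"
proof (induction w arbitrary: k)
  case (Cons i w)
  let ?u = "word_prod n w v"
  have u: "?u k \<le> 0" for k using Cons by simp
  have "?u i = 0" using Cons.prems by (simp add: word_prod_untouched)
  then have "0 \<le> cartan n i k * ?u k" for k
    using u[of k] by (auto simp: cartan_def)
  then have "0 \<le> pairing n i ?u" unfolding pairing_def by (intro sum_nonneg) simp
  then show ?case using u \<open>?u i = 0\<close> by (simp add: simple_refl_eq)
qed simp

text \<open>
  Let \<open>g\<close> have the words \<open>i u\<close> and \<open>x i y\<close>, both without repetitions.  The first word shows that all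
  coordinates of the image of the \<open>i\<close>-th simple root under the inverse of \<open>g\<close> are at most 0.  But if
  \<open>k\<close> were the first letter of \<open>x\<close> adjacent to \<open>i\<close>, the second word would give the coordinate 1 at
  \<open>k\<close>, since no other letter affects that coordinate.  So \<open>i\<close> can be moved to the front.
\<close>

lemma distinct_words_comm_eq:
  "distinct w \<Longrightarrow> distinct w' \<Longrightarrow> set w = set w' \<Longrightarrow> set w \<subseteq> index_set n \<Longrightarrow>
    word_prod n w = word_prod n w' \<Longrightarrow> comm_eq n w w'"
proof (induction w arbitrary: w')
  case (Cons i u)
  have i: "i \<in> index_set n" "i \<notin> set u" using Cons.prems by auto
  have "i \<in> set w'" using Cons.prems(3) by auto
  then obtain x y where w': "w' = x @ i # y" by (meson split_list)
  have xy: "i \<notin> set x" "i \<notin> set y" "distinct (x @ y)" "set (x @ y) = set u"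
    using Cons.prems w' by auto
  let ?r = "simple_root i"
  have inv: "word_prod n (rev (i # u)) ?r = word_prod n (rev w') ?r"
  proof -
    let ?z = "word_prod n (rev w') ?r"
    have "word_prod n (rev (i # u)) (word_prod n (i # u) ?z) = ?z"
      by (rule word_prod_rev[OF Cons.prems(4)])
    moreover have "word_prod n (i # u) ?z = ?r"
      unfolding Cons.prems(5) using Cons.prems(3,4) by (intro word_prod_rev') simp
    ultimately show ?thesis by simp
  qed
  have comm: "cartan n j i = 0" if "j \<in> set x" for j
  proof (rule ccontr)
    assume "cartan n j i \<noteq> 0"
    then obtain x0 k x1 where x: "x = x0 @ k # x1" "cartan n k i \<noteq> 0" "\<forall>j \<in> set x0. cartan n j i = 0"
      using split_list_first_prop[of x "\<lambda>j. cartan n j i \<noteq> 0"] \<open>j \<in> set x\<close> by blast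
    then have k: "k \<noteq> i" "k \<notin> set x0" "k \<notin> set x1" "k \<notin> set y" using xy by auto
    have "set x0 \<subseteq> {j. cartan n j i = 0}" using x by auto
    then have "word_prod n (rev x0) ?r = ?r"
    proof (induction x0 rule: rev_induct)
      case (snoc j x0)
      then have j: "cartan n j i = 0" by simp
      then have "simple_refl n j ?r = ?r"
        using i cartan_zero_imp_neq[OF j] by (simp add: simple_refl_eq pairing_simple_root)
      then show ?case using snoc by (simp add: simple_refl_eq pairing_simple_root i)
    qed simp
    then have "word_prod n (rev w') ?r k = simple_refl n k ?r k"
      using w' x k by (simp add: word_prod_untouched) (simp add: simple_refl_eq word_prod_untouched)
    also have "\<dots> = 1"
      using i k x(2) by (simp add: simple_refl_eq pairing_simple_root cartan_def split: if_splits)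
        (simp add: simple_root_def)
    finally have "word_prod n (rev (i # u)) ?r k = 1" using inv by simp
    moreover have "word_prod n (rev (i # u)) ?r k \<le> 0"
    proof -
      have "simple_refl n i ?r = (\<lambda>j. if j = i then - 1 else 0)"
        using i by (intro ext) (simp add: simple_refl_eq pairing_simple_root cartan_def, simp add: simple_root_def)
      then show ?thesis using i Cons.prems by (simp, intro word_prod_nonpos) auto
    qed
    ultimately show False by simp
  qed
  have e: "comm_eq n w' (i # x @ y)" using comm w' comm_eq_move_to_front by blast
  have "word_prod n u v = word_prod n (x @ y) v" for v
  proof -
    have "simple_refl n i (word_prod n u v) = simple_refl n i (word_prod n (x @ y) v)"
      using Cons.prems(5) word_prod_comm_eq[OF e] by (metis word_prod_simps(2))
    then show ?thesis using simple_refl_involution[OF i(1)] by metis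
  qed
  then have "comm_eq n u (x @ y)" using Cons.prems xy by (intro Cons.IH) auto
  then have "comm_eq n (i # u) (i # x @ y)" by (rule comm_eq_Cons)
  then show ?case using comm_eq_sym[OF e] by (rule rtranclp_trans)
qed simp

lemma weyl_length_le: "set w \<subseteq> index_set n \<Longrightarrow> weyl_length n (word_prod n w) \<le> length w"
  unfolding weyl_length_def by (rule Least_le) auto

lemma weyl_length_attained:
  assumes "set w \<subseteq> index_set n"
  obtains w' where "set w' \<subseteq> index_set n" "word_prod n w' = word_prod n w"
    "length w' = weyl_length n (word_prod n w)"
proof -
  have "\<exists>w' \<in> lists (index_set n). word_prod n w' = word_prod n w \<and>
      length w' = weyl_length n (word_prod n w)"
    unfolding weyl_length_def by (rule LeastI_ex) (use assms in blast)
  then show ?thesis using that by (auto simp: in_lists_conv_set subset_iff)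
qed

lemma reduced_iff: "reduced n w \<longleftrightarrow> set w \<subseteq> index_set n \<and> length w = weyl_length n (word_prod n w)"
  by (auto simp: reduced_def)

lemma reduced_comm_eq: "comm_eq n u w \<Longrightarrow> reduced n u \<longleftrightarrow> reduced n w"
  by (simp add: reduced_iff comm_eq_set comm_eq_length word_prod_comm_eq)

lemma distinct_word_reduced:
  assumes w: "distinct w" "set w \<subseteq> index_set n"
  shows "reduced n w"
proof -
  obtain w' where w': "word_prod n w' = word_prod n w" "length w' = weyl_length n (word_prod n w)"
    by (rule weyl_length_attained[OF w(2)])
  have "length w \<le> length w'"
    using support_subset[OF w w'(1)[symmetric]] distinct_card[OF w(1)] card_mono[of "set w'" "set w"]
      card_length[of w'] by simp
  then show ?thesis using weyl_length_le[OF w(2)] w'(2) w(2) by (simp add: reduced_iff)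
qed

text \<open>
  A reduced word is not longer than the word without repetitions, but by comparison of supports it
  contains the same letters; so it has no repetitions either.
\<close>

lemma reduced_words_distinct:
  assumes w: "distinct w" "set w \<subseteq> index_set n" and w': "reduced n w'" "word_prod n w' = word_prod n w"
  shows "comm_eq n w w'"
proof (rule distinct_words_comm_eq[OF w(1) _ _ w(2) w'(2)[symmetric]])
  have len: "length w' = length w"
    using w' distinct_word_reduced[OF w] by (simp add: reduced_iff)
  have sub: "set w \<subseteq> set w'" by (rule support_subset[OF w w'(2)[symmetric]])
  have "card (set w') \<le> card (set w)" using card_length[of w'] len distinct_card[OF w(1)] by simp
  then show "set w = set w'" using sub by (intro card_subset_eq) (auto intro: le_antisym card_mono)
  then show "distinct w'" using len distinct_card[OF w(1)] by (intro card_distinct) simp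
qed

section \<open>Orthogonal coordinates\<close>

text \<open>
  Coordinates in the orthonormal basis in which the simple roots are \<open>e i - e (i + 1)\<close> for
  \<open>i \<le> n\<close> and \<open>e n + e (n + 1)\<close>.  The simple reflections exchange two neighbouring coordinates,
  the last one with a change of both signs, and \<open>vee\<close> changes the sign of the last coordinate.
\<close>

definition coords :: "nat \<Rightarrow> vec \<Rightarrow> vec" where
  "coords n v = (\<lambda>j. if j = n + 1 then v (n + 1) - v n
    else if j = n then v n - v (n - 1) + v (n + 1)
    else if 2 \<le> j \<and> j < n then v j - v (j - 1) else v j)"

definition signed_swap :: "nat \<Rightarrow> nat \<Rightarrow> vec \<Rightarrow> vec" where
  "signed_swap n i y =
    (if i = n + 1 then y(n := - y (n + 1), n + 1 := - y n) else y(i := y (i + 1), i + 1 := y i))"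

definition negate_last :: "nat \<Rightarrow> vec \<Rightarrow> vec" where
  "negate_last n y = y(n + 1 := - y (n + 1))"

definition negate :: "nat \<Rightarrow> vec \<Rightarrow> vec" where
  "negate n v = (\<lambda>j. if j \<in> index_set n then - v j else v j)"

lemma pairing_neighbours:
  assumes "i \<in> index_set n" "N \<subseteq> index_set n" "i \<notin> N"
    and N: "\<And>k. k \<in> index_set n \<Longrightarrow> k \<noteq> i \<Longrightarrow> {i, k} \<in> dynkin_edges n \<longleftrightarrow> k \<in> N"
  shows "pairing n i v = 2 * v i - (\<Sum>k \<in> N. v k)"
proof -
  have fin: "finite N" using assms(2) finite_index_set finite_subset by blast
  have "pairing n i v = (\<Sum>k \<in> insert i N. cartan n i k * v k)"
    unfolding pairing_def using assms by (intro sum.mono_neutral_right) (auto simp: cartan_def)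
  also have "\<dots> = 2 * v i + (\<Sum>k \<in> N. cartan n i k * v k)"
    using fin assms(3) by (simp add: cartan_def)
  also have "(\<Sum>k \<in> N. cartan n i k * v k) = (\<Sum>k \<in> N. - v k)"
    using assms by (intro sum.cong refl) (auto simp: cartan_def subset_iff)
  finally show ?thesis by (simp add: sum_negf)
qed

lemma pairing_coords:
  assumes n: "n \<ge> 3" and i: "i \<in> index_set n"
  shows "pairing n i v =
    (if i = n + 1 then coords n v n + coords n v (n + 1) else coords n v i - coords n v (i + 1))"
proof -
  consider "i = 1" | "2 \<le> i" "i < n - 1" | "i = n - 1" | "i = n" | "i = n + 1"
    using i by (force simp: index_set_def)
  then show ?thesis
  proof cases
    case 1
    then have "pairing n i v = 2 * v i - (\<Sum>k \<in> {2}. v k)"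
      using n by (intro pairing_neighbours) (auto simp: dynkin_edge_iff index_set_def)
    then show ?thesis using 1 n by (simp add: coords_def numeral_2_eq_2)
  next
    case 2
    then have "pairing n i v = 2 * v i - (\<Sum>k \<in> {i - 1, i + 1}. v k)"
      using n by (intro pairing_neighbours) (auto simp: dynkin_edge_iff index_set_def)
    moreover have "Suc i < n" "2 \<le> Suc i" "i \<noteq> n" "i \<noteq> n + 1" using 2 by simp_all
    ultimately show ?thesis using 2 by (simp add: coords_def)
  next
    case 3
    then have "pairing n i v = 2 * v i - (\<Sum>k \<in> {n - 2, n, n + 1}. v k)"
      using n by (intro pairing_neighbours) (auto simp: dynkin_edge_iff index_set_def)
    moreover obtain m where "n = m + 3" using n by (metis le_add_diff_inverse2)
    ultimately show ?thesis using 3 by (simp add: coords_def)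
  next
    case 4
    then have "pairing n i v = 2 * v i - (\<Sum>k \<in> {n - 1}. v k)"
      using n by (intro pairing_neighbours) (auto simp: dynkin_edge_iff index_set_def)
    then show ?thesis using 4 n by (simp add: coords_def)
  next
    case 5
    then have "pairing n i v = 2 * v i - (\<Sum>k \<in> {n - 1}. v k)"
      using n by (intro pairing_neighbours) (auto simp: dynkin_edge_iff index_set_def)
    then show ?thesis using 5 n by (simp add: coords_def)
  qed
qed

lemma coords_update:
  assumes n: "n \<ge> 3" and i: "i \<in> index_set n"
  shows "coords n (v(i := v i - d)) j = coords n v j +
    (if i = n + 1 then (if j = n \<or> j = n + 1 then - d else 0)
     else if j = i then - d else if j = i + 1 then d else 0)"
proof -
  consider "j = n + 1" | "j = n" | "2 \<le> j" "j < n" | "j < 2" | "j > n + 1" using n by linarith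
  then show ?thesis
    by cases (use n i in \<open>auto simp: coords_def index_set_def\<close>)
qed

lemma coords_simple_refl:
  assumes n: "n \<ge> 3" and i: "i \<in> index_set n"
  shows "coords n (simple_refl n i v) = signed_swap n i (coords n v)"
proof
  fix j
  show "coords n (simple_refl n i v) j = signed_swap n i (coords n v) j"
    unfolding simple_refl_eq coords_update[OF n i] pairing_coords[OF n i]
    by (simp add: signed_swap_def)
qed

lemma coords_vee_map: "n \<ge> 3 \<Longrightarrow> coords n (vee_map n v) = negate_last n (coords n v)"
  by (auto simp: coords_def negate_last_def vee_map_def vee_def fun_eq_iff)

lemma coords_negate: "n \<ge> 3 \<Longrightarrow> coords n (negate n v) = negate n (coords n v)"
  by (auto simp: coords_def negate_def index_set_def fun_eq_iff)

lemma coords_inj: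
  assumes n: "n \<ge> 3" and eq: "coords n u = coords n v"
  shows "u = v"
proof
  fix j
  have eq': "coords n u j = coords n v j" for j using eq by simp
  have small: "u j = v j" if "j < n" for j
    using that
  proof (induction j)
    case 0 then show ?case using eq'[of 0] n by (simp add: coords_def)
  next
    case (Suc j)
    then show ?case using eq'[of "Suc j"] n by (cases "j = 0") (auto simp: coords_def)
  qed
  have "u n = v n" "u (n + 1) = v (n + 1)"
    using eq'[of n] eq'[of "n + 1"] small[of "n - 1"] n by (auto simp: coords_def)
  moreover have "u j = v j" if "j > n + 1" using eq'[of j] that by (simp add: coords_def)
  ultimately show "u j = v j" using small by (metis Suc_eq_plus1 linorder_neqE_nat not_less_eq)
qed

definition signed_word :: "nat \<Rightarrow> nat list \<Rightarrow> vec \<Rightarrow> vec" where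
  "signed_word n w y = foldr (signed_swap n) w y"

lemma signed_word_simps [simp]:
  "signed_word n [] y = y"
  "signed_word n (i # w) y = signed_swap n i (signed_word n w y)"
  "signed_word n (u @ w) y = signed_word n u (signed_word n w y)"
  by (simp_all add: signed_word_def)

lemma coords_word_prod:
  "n \<ge> 3 \<Longrightarrow> set w \<subseteq> index_set n \<Longrightarrow> coords n (word_prod n w v) = signed_word n w (coords n v)"
  by (induction w) (simp_all add: coords_simple_refl)

section \<open>Powers of twisted Coxeter elements\<close>

lemma vee_map_vee_map [simp]: "vee_map n (vee_map n v) = v"
  by (simp add: vee_map_def)

lemma vee_map_power_cancel [simp]: "(vee_map n ^^ k) ((vee_map n ^^ k) v) = v"
  by (induction k arbitrary: v) (simp_all add: funpow_swap1)

lemma simple_refl_vee: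
  assumes n: "n \<ge> 3"
  shows "simple_refl n (vee n i) (vee_map n v) = vee_map n (simple_refl n i v)"
proof -
  have "pairing n (vee n i) (vee_map n v) = (\<Sum>k \<in> index_set n. cartan n (vee n i) (vee n k) * v k)"
    unfolding pairing_def vee_map_def
    using n by (intro sum.reindex_bij_witness[of _ "vee n" "vee n"]) auto
  then have "pairing n (vee n i) (vee_map n v) = pairing n i v"
    by (simp add: cartan_vee[OF n] pairing_def)
  then show ?thesis by (auto simp: simple_refl_eq vee_map_def fun_eq_iff)
qed

lemma word_prod_map_vee:
  assumes n: "n \<ge> 3"
  shows "word_prod n (map (vee n) w) v = vee_map n (word_prod n w (vee_map n v))"
proof (induction w)
  case (Cons i w)
  then show ?case using simple_refl_vee[OF n, of i "word_prod n w (vee_map n v)"] by simp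
qed simp

lemma word_prod_map_vee_power:
  assumes n: "n \<ge> 3"
  shows "word_prod n (map (vee n ^^ k) w) v = (vee_map n ^^ k) (word_prod n w ((vee_map n ^^ k) v))"
proof (induction k arbitrary: v)
  case (Suc k)
  have "map (vee n ^^ Suc k) w = map (vee n) (map (vee n ^^ k) w)" by simp
  then have "word_prod n (map (vee n ^^ Suc k) w) v =
      vee_map n ((vee_map n ^^ k) (word_prod n w ((vee_map n ^^ k) (vee_map n v))))"
    using word_prod_map_vee[OF n] Suc by metis
  also have "vee_map n ((vee_map n ^^ k) u) = (vee_map n ^^ Suc k) u" for u by simp
  also have "(vee_map n ^^ k) (vee_map n v) = (vee_map n ^^ Suc k) v" by (simp add: funpow_swap1)
  finally show ?case .
qed simp

lemma word_prod_twisted_power: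
  assumes n: "n \<ge> 3"
  shows "word_prod n (twisted_power n m w) v =
    ((word_prod n w \<circ> vee_map n) ^^ m) ((vee_map n ^^ m) v)"
proof (induction m arbitrary: v)
  case (Suc m)
  let ?F = "word_prod n w \<circ> vee_map n"
  have "word_prod n (twisted_power n (Suc m) w) v = (?F ^^ m) (word_prod n w ((vee_map n ^^ m) v))"
    unfolding twisted_power_simps word_prod_append Suc word_prod_map_vee_power[OF n]
      vee_map_power_cancel ..
  also have "word_prod n w ((vee_map n ^^ m) v) = ?F ((vee_map n ^^ Suc m) v)" by simp
  also have "(?F ^^ m) (?F u) = (?F ^^ Suc m) u" for u by (simp only: funpow_Suc_right comp_apply)
  finally show ?case .
qed simp

text \<open>
  In orthogonal coordinates the twisted Coxeter element of the word \<open>1 \<dots> n\<close> is a cyclic shift of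
  all \<open>n + 1\<close> coordinates with one change of sign.
\<close>

definition negative_cycle :: "nat \<Rightarrow> vec \<Rightarrow> vec" where
  "negative_cycle n y =
    (\<lambda>j. if j = 1 then - y (n + 1) else if 2 \<le> j \<and> j \<le> n + 1 then y (j - 1) else y j)"

lemma signed_word_upt:
  "k \<le> n \<Longrightarrow> signed_word n [1..<k + 1] y =
    (\<lambda>j. if j = 1 then y (k + 1) else if 2 \<le> j \<and> j \<le> k + 1 then y (j - 1) else y j)"
proof (induction k arbitrary: y)
  case (Suc k)
  have "[1..<Suc k + 1] = [1..<k + 1] @ [Suc k]" by simp
  then have "signed_word n [1..<Suc k + 1] y = signed_word n [1..<k + 1] (signed_swap n (Suc k) y)"
    by (simp del: upt_Suc)
  also have "\<dots> = (\<lambda>j. if j = 1 then signed_swap n (Suc k) y (k + 1) else if 2 \<le> j \<and> j \<le> k + 1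
      then signed_swap n (Suc k) y (j - 1) else signed_swap n (Suc k) y j)"
    using Suc.prems by (intro Suc.IH) simp
  also have "\<dots> = (\<lambda>j. if j = 1 then y (Suc k + 1) else if 2 \<le> j \<and> j \<le> Suc k + 1 then y (j - 1) else y j)"
    using Suc.prems by (auto simp: signed_swap_def fun_eq_iff)
  finally show ?case .
qed (auto simp: fun_eq_iff)

lemma negative_cycle_power:
  "m \<le> n + 1 \<Longrightarrow> (negative_cycle n ^^ m) y =
    (\<lambda>j. if j \<in> index_set n then if m < j then y (j - m) else - y (n + 1 + j - m) else y j)"
proof (induction m)
  case 0 then show ?case by (auto simp: index_set_def)
next
  case (Suc m)
  then have "(negative_cycle n ^^ Suc m) y = negative_cycle n
      (\<lambda>j. if j \<in> index_set n then if m < j then y (j - m) else - y (n + 1 + j - m) else y j)"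
    by simp
  also have "\<dots> = (\<lambda>j. if j \<in> index_set n then if Suc m < j then y (j - Suc m)
      else - y (n + 1 + j - Suc m) else y j)"
  proof
    fix j
    consider "j = 1" | "2 \<le> j" "j \<le> n + 1" | "j = 0" | "j > n + 1" by linarith
    then show "negative_cycle n
      (\<lambda>j. if j \<in> index_set n then if m < j then y (j - m) else - y (n + 1 + j - m) else y j) j =
      (if j \<in> index_set n then if Suc m < j then y (j - Suc m) else - y (n + 1 + j - Suc m) else y j)"
      using Suc.prems
      by cases (auto simp: negative_cycle_def index_set_def Suc_diff_le intro!: arg_cong[of _ _ y])
  qed
  finally show ?case .
qed

lemma funpow_conjugate:
  assumes "\<And>v. g v = s (f (s v))" "\<And>v. s (s v) = v"
  shows "(g ^^ m) v = s ((f ^^ m) (s v))"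
  by (induction m) (simp_all add: assms)

text \<open>
  Rotating a Coxeter word conjugates its twisted Coxeter element by a simple reflection, which
  commutes with the negation; so it is enough to consider the word \<open>1 \<dots> n\<close>.
\<close>

lemma twisted_coxeter_power:
  assumes n: "n \<ge> 3" and w: "coxeter_word n w"
  shows "(word_prod n w \<circ> vee_map n) ^^ (n + 1) = negate n"
  using n w
proof (induction rule: coxeter_word_induct)
  case base
  let ?F = "word_prod n [1..<n + 1] \<circ> vee_map n"
  have step: "coords n (?F v) = negative_cycle n (coords n v)" for v
  proof -
    have "coords n (?F v) = signed_word n [1..<n + 1] (negate_last n (coords n v))"
      using coords_word_prod[OF n, of "[1..<n + 1]"] coords_vee_map[OF n]
      by (simp add: index_set_def subset_iff del: upt_Suc)
    also have "\<dots> = negative_cycle n (coords n v)"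
      unfolding signed_word_upt[OF le_refl] by (auto simp: negative_cycle_def negate_last_def fun_eq_iff)
    finally show ?thesis .
  qed
  have power: "coords n ((?F ^^ m) v) = (negative_cycle n ^^ m) (coords n v)" for m v
    by (induction m) (simp_all only: funpow.simps comp_apply[of ?F] step id_apply comp_apply[of "negative_cycle n"])
  have "coords n ((?F ^^ (n + 1)) v) = coords n (negate n v)" for v
    unfolding power negative_cycle_power[OF le_refl] coords_negate[OF n]
    by (auto simp: negate_def index_set_def fun_eq_iff)
  then have "(?F ^^ (n + 1)) v = negate n v" for v by (rule coords_inj[OF n])
  then show ?case by (rule ext)
next
  case (comm u v)
  then show ?case using word_prod_comm_eq[of n u v] by simp
next
  case (rot i a)
  have i: "i \<in> index_set n" using coxeter_wordD(3)[OF n rot.hyps] by simp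
  let ?s = "simple_refl n i" and ?f = "word_prod n (a @ [vee n i]) \<circ> vee_map n"
  let ?g = "word_prod n (i # a) \<circ> vee_map n"
  have g: "?g v = ?s (?f (?s v))" for v
    using simple_refl_vee[OF n, of i "?s v"] simple_refl_involution[OF i] by simp
  have conj: "(?g ^^ m) v = ?s ((?f ^^ m) (?s v))" for m v
    by (rule funpow_conjugate[where g = ?g and s = ?s, OF g simple_refl_involution[OF i]])
  have "(?g ^^ (n + 1)) v = ?s (negate n (?s v))" for v
    using conj[of "n + 1" v] unfolding rot.IH .
  also have "?s (negate n u) = negate n (?s u)" for u
  proof -
    have "pairing n i (negate n u) = - pairing n i u"
      unfolding pairing_def sum_negf[symmetric] by (intro sum.cong refl) (simp add: negate_def)
    then show ?thesis using i by (auto simp: simple_refl_eq negate_def fun_eq_iff)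
  qed
  finally have "(?g ^^ (n + 1)) v = negate n v" for v unfolding simple_refl_involution[OF i] .
  then show ?case by (rule ext)
qed

text \<open>
  Minus the identity up to \<open>vee\<close>; this is going to be the longest element.
\<close>

definition opposition :: "nat \<Rightarrow> vec \<Rightarrow> vec" where
  "opposition n v = negate n ((vee_map n ^^ (n + 1)) v)"

lemma word_prod_twisted_word:
  "n \<ge> 3 \<Longrightarrow> coxeter_word n w \<Longrightarrow> word_prod n (twisted_word n w) = opposition n"
  by (rule ext) (simp only: twisted_word_eq word_prod_twisted_power twisted_coxeter_power opposition_def)

section \<open>Length and the longest element\<close>

definition positive_pairs :: "nat \<Rightarrow> (nat \<times> nat) set" where
  "positive_pairs n = {(a, b). 1 \<le> a \<and> a < b \<and> b \<le> n + 1}"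

definition defect :: "int \<Rightarrow> int \<Rightarrow> nat" where
  "defect s t = of_bool (s < t) + of_bool (s + t < 0)"

text \<open>
  The pair \<open>(a, b)\<close> stands for the two positive roots \<open>e a - e b\<close> and \<open>e a + e b\<close>, so this counts the
  positive roots at which a vector is negative.
\<close>

definition inversions :: "nat \<Rightarrow> vec \<Rightarrow> nat" where
  "inversions n y = (\<Sum>(a, b) \<in> positive_pairs n. defect (y a) (y b))"

lemma finite_positive_pairs [simp]: "finite (positive_pairs n)"
  by (rule finite_subset[of _ "{1..n + 1} \<times> {1..n + 1}"]) (auto simp: positive_pairs_def)

lemma card_positive_pairs: "2 * card (positive_pairs n) = n * (n + 1)"
proof (induction n)
  case 0
  have "positive_pairs 0 = {}" by (auto simp: positive_pairs_def)
  then show ?case by simp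
next
  case (Suc n)
  have "positive_pairs (Suc n) = positive_pairs n \<union> (\<lambda>a. (a, n + 2)) ` {1..n + 1}"
    by (auto simp: positive_pairs_def)
  moreover have "positive_pairs n \<inter> (\<lambda>a. (a, n + 2)) ` {1..n + 1} = {}"
    by (auto simp: positive_pairs_def)
  moreover have "card ((\<lambda>a. (a, n + 2)) ` {1..n + 1}) = n + 1"
    by (subst card_image) (auto simp: inj_on_def)
  ultimately show ?case using Suc by (simp add: card_Un_disjoint)
qed

lemma inversions_negate_last: "inversions n (negate_last n y) = inversions n y"
  unfolding inversions_def
  by (intro sum.cong refl) (auto simp: positive_pairs_def negate_last_def defect_def)

text \<open>
  The transposition of two neighbouring indices permutes all other pairs, and for the pair itself
  the sum is unchanged while the difference changes its sign.
\<close>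

lemma inversions_swap:
  assumes i: "i \<in> {1..n}"
  shows "inversions n (y(i := y (i + 1), i + 1 := y i)) + of_bool (y i < y (i + 1)) =
    inversions n y + of_bool (y (i + 1) < y i)"
proof -
  let ?y = "y(i := y (i + 1), i + 1 := y i)"
  let ?P = "positive_pairs n - {(i, i + 1)}"
  define \<tau> where "\<tau> = id(i := i + 1, i + 1 := i)"
  have \<tau>: "\<tau> (\<tau> a) = a" "?y a = y (\<tau> a)" for a by (auto simp: \<tau>_def)
  have "(i, i + 1) \<in> positive_pairs n" using i by (simp add: positive_pairs_def)
  then have split: "inversions n z = defect (z i) (z (i + 1)) + (\<Sum>(a, b) \<in> ?P. defect (z a) (z b))" for z
    unfolding inversions_def by (subst sum.remove[of _ "(i, i + 1)"]) auto
  have maps: "(\<tau> a, \<tau> b) \<in> ?P" if "(a, b) \<in> ?P" for a b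
    using that i by (auto simp: positive_pairs_def \<tau>_def split: if_splits)
  have "(\<Sum>(a, b) \<in> ?P. defect (?y a) (?y b)) = (\<Sum>(a, b) \<in> ?P. defect (y a) (y b))"
    using maps \<tau>
    by (intro sum.reindex_bij_witness[of _ "\<lambda>(a, b). (\<tau> a, \<tau> b)" "\<lambda>(a, b). (\<tau> a, \<tau> b)"])
      (auto simp del: fun_upd_apply)
  moreover have "defect (?y i) (?y (i + 1)) + of_bool (y i < y (i + 1)) =
      defect (y i) (y (i + 1)) + of_bool (y (i + 1) < y i)"
    by (auto simp: defect_def add.commute)
  ultimately show ?thesis unfolding split[of ?y] split[of y] by linarith
qed

text \<open>
  Negativity at the \<open>i\<close>-th simple root, in orthogonal coordinates.
\<close>

definition descent :: "nat \<Rightarrow> nat \<Rightarrow> vec \<Rightarrow> bool" where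
  "descent n i y \<longleftrightarrow> (if i = n + 1 then y n + y (n + 1) < 0 else y i < y (i + 1))"

lemma signed_swap_last:
  "n \<ge> 1 \<Longrightarrow> signed_swap n (n + 1) y = negate_last n (signed_swap n n (negate_last n y))"
  by (auto simp: signed_swap_def negate_last_def fun_eq_iff)

text \<open>
  The last simple reflection is conjugate to the previous one by a change of sign of the last
  coordinate, which only exchanges the two roots belonging to each pair \<open>(a, n + 1)\<close>.
\<close>

lemma inversions_signed_swap:
  assumes n: "n \<ge> 1" and i: "i \<in> index_set n"
  shows "inversions n (signed_swap n i y) \<le> inversions n y + 1"
    and "descent n i y \<Longrightarrow> inversions n (signed_swap n i y) + 1 = inversions n y"
proof -
  have *: "inversions n (signed_swap n i y) \<le> inversions n y + 1 \<and>
      (y i < y (i + 1) \<longrightarrow> inversions n (signed_swap n i y) + 1 = inversions n y)"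
    if "i \<in> {1..n}" for i y
    using inversions_swap[OF that, of y] that by (auto simp: signed_swap_def of_bool_def split: if_splits)
  show "inversions n (signed_swap n i y) \<le> inversions n y + 1"
  proof (cases "i = n + 1")
    case True
    show ?thesis
      using *[of n "negate_last n y"] n
      unfolding True signed_swap_last[OF n] inversions_negate_last by simp
  next
    case False
    then show ?thesis using *[of i y] i by (simp add: index_set_def)
  qed
  show "inversions n (signed_swap n i y) + 1 = inversions n y" if d: "descent n i y"
  proof (cases "i = n + 1")
    case True
    have "negate_last n y n < negate_last n y (n + 1)"
      using d True by (simp add: descent_def negate_last_def)
    then show ?thesis
      using *[of n "negate_last n y"] n
      unfolding True signed_swap_last[OF n] inversions_negate_last by simp
  next
    case False
    then show ?thesis using *[of i y] i d by (simp add: index_set_def descent_def)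
  qed
qed

text \<open>
  Every positive root is a sum of simple roots, at which the vector is nonnegative.
\<close>

lemma no_descent_inversions:
  assumes "\<And>i. i \<in> index_set n \<Longrightarrow> \<not> descent n i y"
  shows "inversions n y = 0"
proof -
  have step: "y (a + 1) \<le> y a" if "1 \<le> a" "a \<le> n" for a
    using assms[of a] that by (simp add: descent_def index_set_def)
  have anti: "b \<le> n + 1 \<Longrightarrow> y b \<le> y a" if "1 \<le> a" "a \<le> b" for a b
    using that(2)
  proof (induction b rule: dec_induct)
    case (step b)
    then show ?case using \<open>\<And>a. 1 \<le> a \<Longrightarrow> a \<le> n \<Longrightarrow> y (a + 1) \<le> y a\<close>[of b] that(1) by force
  qed simp
  have last: "0 \<le> y n + y (n + 1)"
    using assms[of "n + 1"] by (simp add: descent_def index_set_def)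
  have "defect (y a) (y b) = 0" if "(a, b) \<in> positive_pairs n" for a b
    using that anti[of a b] anti[of a n] anti[of b "n + 1"] last
    by (auto simp: defect_def positive_pairs_def)
  then show ?thesis unfolding inversions_def by (intro sum.neutral) auto
qed

text \<open>
  A regular dominant vector, given by its coefficients at the simple roots.  Its orthogonal
  coordinates \<open>4 (n + 1 - j) + 2\<close> are even, so that these coefficients are integers, they are
  decreasing, so that there are no inversions, and none of them vanishes, so that no change of sign
  goes unnoticed.
\<close>

definition regular_vec :: "nat \<Rightarrow> vec" where
  "regular_vec n = (\<lambda>j. if j = n then (int n)\<^sup>2 + 2 * int n - 1
    else if j = n + 1 then (int n)\<^sup>2 + 2 * int n + 1
    else 4 * (int n + 1) * int j - 2 * (int j)\<^sup>2)"

definition regular_coord :: "nat \<Rightarrow> nat \<Rightarrow> int" where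
  "regular_coord n j = 4 * (int n + 1 - int j) + 2"

lemma coords_regular_vec:
  assumes n: "n \<ge> 3" and j: "j \<in> index_set n"
  shows "coords n (regular_vec n) j = regular_coord n j"
proof -
  have p: "int (j - 1) = int j - 1" "int (n - 1) = int n - 1" using j n by (auto simp: index_set_def)
  consider "j = n + 1" | "j = n" | "2 \<le> j" "j < n" | "j = 1" using j by (force simp: index_set_def)
  then show ?thesis
    by cases (use n p in \<open>auto simp: coords_def regular_vec_def regular_coord_def power2_eq_square algebra_simps\<close>)
qed

text \<open>
  Each simple reflection transposes two coordinates and changes no sign or two signs, so the number of
  sign changes stays even; this is what distinguishes type D from type B.
\<close>

lemma signed_word_form:
  assumes n: "n \<ge> 3"
  shows "set w \<subseteq> index_set n \<Longrightarrow> \<exists>\<sigma> \<epsilon>. \<sigma> permutes index_set n \<and> (\<forall>j. \<epsilon> j = 1 \<or> \<epsilon> j = (-1 :: int)) \<and>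
    (\<Prod>j \<in> index_set n. \<epsilon> j) = 1 \<and>
    (\<forall>y. signed_word n w y = (\<lambda>j. if j \<in> index_set n then \<epsilon> j * y (\<sigma> j) else y j))"
proof (induction w)
  case Nil
  show ?case by (intro exI[of _ id] exI[of _ "\<lambda>_. 1"]) (simp add: permutes_id[unfolded id_def] fun_eq_iff)
next
  case (Cons i w)
  then obtain \<sigma> \<epsilon> where form: "\<sigma> permutes index_set n" "\<And>j. \<epsilon> j = 1 \<or> \<epsilon> j = (-1 :: int)"
      "(\<Prod>j \<in> index_set n. \<epsilon> j) = 1"
      "\<And>y. signed_word n w y = (\<lambda>j. if j \<in> index_set n then \<epsilon> j * y (\<sigma> j) else y j)"
    by auto
  define k where "k = min i n"
  have i: "i \<in> index_set n" using Cons.prems by simp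
  have k: "k \<in> index_set n" "k + 1 \<in> index_set n" "i = k \<or> i = n + 1 \<and> k = n" "k \<le> n"
    using i n by (auto simp: k_def index_set_def)
  let ?\<tau> = "transpose k (k + 1)"
  define \<delta> where "\<delta> j = (if i = n + 1 \<and> (j = n \<or> j = n + 1) then -1 else 1 :: int)" for j
  have \<tau>: "?\<tau> permutes index_set n" using k by (intro permutes_swap_id)
  have "(\<Prod>j \<in> index_set n. \<delta> j) = 1"
  proof (cases "i = n + 1")
    case True
    have "(\<Prod>j \<in> index_set n. \<delta> j) = (\<Prod>j \<in> {n, n + 1}. \<delta> j)"
      using n by (intro prod.mono_neutral_right) (auto simp: \<delta>_def index_set_def)
    then show ?thesis using True by (simp add: \<delta>_def)
  qed (simp add: \<delta>_def)
  moreover have "(\<Prod>j \<in> index_set n. \<epsilon> (?\<tau> j)) = 1"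
    using prod.permute[OF \<tau>, of \<epsilon>] form(3) by (simp add: comp_def)
  ultimately have "(\<Prod>j \<in> index_set n. \<delta> j * \<epsilon> (?\<tau> j)) = 1" by (simp add: prod.distrib)
  moreover have "signed_word n (i # w) y =
      (\<lambda>j. if j \<in> index_set n then (\<delta> j * \<epsilon> (?\<tau> j)) * y ((\<sigma> \<circ> ?\<tau>) j) else y j)" for y
  proof -
    have "signed_swap n i z = (\<lambda>j. \<delta> j * z (?\<tau> j))" for z :: vec
      using k by (auto simp: signed_swap_def \<delta>_def transpose_def fun_eq_iff)
    moreover have "?\<tau> j \<in> index_set n \<longleftrightarrow> j \<in> index_set n" for j
      using permutes_in_image[OF \<tau>] by blast
    moreover have "j \<notin> index_set n \<Longrightarrow> ?\<tau> j = j \<and> \<delta> j = 1" for j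
      using permutes_not_in[OF \<tau>] n by (auto simp: \<delta>_def index_set_def)
    ultimately show ?thesis by (auto simp: form(4) fun_eq_iff)
  qed
  moreover have "\<delta> j * \<epsilon> (?\<tau> j) = 1 \<or> \<delta> j * \<epsilon> (?\<tau> j) = -1" for j
    using form(2)[of "?\<tau> j"] by (auto simp: \<delta>_def)
  ultimately show ?case
    using permutes_compose[OF \<tau> form(1)]
    by (intro exI[of _ "\<sigma> \<circ> ?\<tau>"] exI[of _ "\<lambda>j. \<delta> j * \<epsilon> (?\<tau> j)"])
      (simp add: comp_def)
qed

text \<open>
  The number of positive roots that the inverse of the element makes negative.  It is read off from
  the image of a regular vector, and it will turn out to be the length.
\<close>

definition height :: "nat \<Rightarrow> nat list \<Rightarrow> nat" where
  "height n w = inversions n (coords n (word_prod n w (regular_vec n)))"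

lemma height_Nil: "n \<ge> 3 \<Longrightarrow> height n [] = 0"
  unfolding height_def inversions_def
  by (intro sum.neutral)
    (auto simp: positive_pairs_def coords_regular_vec index_set_def defect_def regular_coord_def)

text \<open>
  Without inversions the image of the regular vector is still strictly decreasing.  Its entries
  are those of the regular vector up to order and signs; the first \<open>n\<close> of them are positive, and
  the number of negative ones is even, so nothing has moved.
\<close>

lemma height_zero:
  assumes n: "n \<ge> 3" and w: "set w \<subseteq> index_set n" and h: "height n w = 0"
  shows "word_prod n w = id"
proof -
  obtain \<sigma> \<epsilon> where form: "\<sigma> permutes index_set n" "\<And>j. \<epsilon> j = 1 \<or> \<epsilon> j = (-1 :: int)"
      "(\<Prod>j \<in> index_set n. \<epsilon> j) = 1"
      "\<And>y. signed_word n w y = (\<lambda>j. if j \<in> index_set n then \<epsilon> j * y (\<sigma> j) else y j)"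
    using signed_word_form[OF n w] by blast
  let ?y = "coords n (word_prod n w (regular_vec n))" and ?r = "regular_coord n"
  have \<sigma>I: "\<sigma> j \<in> index_set n \<longleftrightarrow> j \<in> index_set n" for j by (rule permutes_in_image[OF form(1)])
  have y: "?y j = \<epsilon> j * ?r (\<sigma> j)" if "j \<in> index_set n" for j
    using that by (simp add: coords_word_prod[OF n w] form(4) coords_regular_vec[OF n] \<sigma>I)
  have pos: "0 < ?r (\<sigma> j)" if "j \<in> index_set n" for j
    using \<sigma>I[of j] that by (simp add: regular_coord_def index_set_def)
  have "\<forall>p \<in> positive_pairs n. (\<lambda>(a, b). defect (?y a) (?y b)) p = 0"
    using h unfolding height_def inversions_def by (subst (asm) sum_eq_0_iff) simp_all
  then have noinv: "?y b \<le> ?y a" "0 \<le> ?y a + ?y b" if "(a, b) \<in> positive_pairs n" for a b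
    using that by (force simp: defect_def)+
  have \<epsilon>1: "\<epsilon> a = 1" if "a \<in> {1..n}" for a
  proof (rule ccontr)
    assume "\<epsilon> a \<noteq> 1"
    then have "?y a < 0" using form(2)[of a] y[of a] pos[of a] that by (auto simp: index_set_def)
    moreover have "0 \<le> ?y a" using noinv[of a "n + 1"] that by (simp add: positive_pairs_def)
    ultimately show False by simp
  qed
  have "(\<Prod>j \<in> index_set n. \<epsilon> j) = \<epsilon> (n + 1) * (\<Prod>j \<in> {1..n}. \<epsilon> j)"
    by (simp add: index_set_def atLeastAtMostSuc_conv)
  then have "\<epsilon> (n + 1) = 1" using form(3) \<epsilon>1 by simp
  then have \<epsilon>: "\<epsilon> j = 1" if "j \<in> index_set n" for j
    using that \<epsilon>1 by (cases "j = n + 1") (auto simp: index_set_def)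
  have mono: "\<sigma> a < \<sigma> b" if "(a, b) \<in> positive_pairs n" for a b
  proof -
    have ab: "a \<in> index_set n" "b \<in> index_set n" "a \<noteq> b"
      using that by (auto simp: positive_pairs_def index_set_def)
    then have "?r (\<sigma> b) \<le> ?r (\<sigma> a)" using noinv(1)[OF that] y \<epsilon> by simp
    then have "\<sigma> a \<le> \<sigma> b" by (simp add: regular_coord_def)
    moreover have "\<sigma> a \<noteq> \<sigma> b" using permutes_inj[OF form(1)] ab(3) by (auto dest: injD)
    ultimately show ?thesis by simp
  qed
  have ge: "a \<le> \<sigma> a" if "a \<in> index_set n" for a
    using that
  proof (induction a)
    case (Suc a)
    show ?case
    proof (cases "a = 0")
      case True then show ?thesis using \<sigma>I[of "Suc a"] Suc.prems by (auto simp: index_set_def)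
    next
      case False
      then have "a \<le> \<sigma> a" using Suc by (simp add: index_set_def)
      moreover have "\<sigma> a < \<sigma> (Suc a)"
        using False Suc.prems by (intro mono) (simp add: positive_pairs_def index_set_def)
      ultimately show ?thesis by simp
    qed
  qed simp
  have le: "1 \<le> a \<Longrightarrow> \<sigma> a \<le> a" if "a \<le> n + 1" for a
    using that
  proof (induction a rule: inc_induct)
    case base then show ?case using \<sigma>I[of "n + 1"] by (simp add: index_set_def)
  next
    case (step a)
    then have "\<sigma> a < \<sigma> (Suc a)" by (intro mono) (simp add: positive_pairs_def)
    then show ?case using step by simp
  qed
  have "\<sigma> a = a" if "a \<in> index_set n" for a
    using ge[OF that] le[of a] that by (simp add: index_set_def)
  then have "signed_word n w y = y" for y using \<epsilon> by (auto simp: form(4) fun_eq_iff)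
  then have "coords n (word_prod n w v) = coords n v" for v by (simp add: coords_word_prod[OF n w])
  then have "word_prod n w v = id v" for v unfolding id_apply by (rule coords_inj[OF n])
  then show ?thesis by (rule ext)
qed

lemma height_Cons:
  assumes n: "n \<ge> 3" and i: "i \<in> index_set n"
  shows "height n (i # w) = inversions n (signed_swap n i (coords n (word_prod n w (regular_vec n))))"
  by (simp add: height_def coords_simple_refl[OF n i])

lemma height_le_length:
  assumes n: "n \<ge> 3"
  shows "set w \<subseteq> index_set n \<Longrightarrow> height n w \<le> length w"
proof (induction w)
  case Nil then show ?case using height_Nil[OF n] by simp
next
  case (Cons i w)
  then show ?case
    using inversions_signed_swap(1)[of n i "coords n (word_prod n w (regular_vec n))"] n
      height_Cons[OF n, of i w] by (simp add: height_def)
qed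

text \<open>
  As long as there are inversions there is a descent, and the corresponding simple reflection
  removes exactly one inversion.
\<close>

lemma word_of_height:
  assumes n: "n \<ge> 3"
  shows "set w \<subseteq> index_set n \<Longrightarrow>
    \<exists>w'. set w' \<subseteq> index_set n \<and> word_prod n w' = word_prod n w \<and> length w' \<le> height n w"
proof (induction "height n w" arbitrary: w)
  case 0
  have "word_prod n [] = word_prod n w"
    using height_zero[OF n 0(2)] 0(1) by (simp add: word_prod_def)
  then show ?case by (intro exI[of _ "[]"]) simp
next
  case (Suc m)
  let ?y = "coords n (word_prod n w (regular_vec n))"
  obtain i where i: "i \<in> index_set n" "descent n i ?y"
    using no_descent_inversions[of n ?y] Suc.hyps(2) unfolding height_def by fastforce
  have "m = height n (i # w)"
    using inversions_signed_swap(2)[OF _ i] height_Cons[OF n i(1)] Suc.hyps(2) n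
    by (simp add: height_def)
  from Suc.hyps(1)[OF this] obtain w' where w': "set w' \<subseteq> index_set n"
      "word_prod n w' = word_prod n (i # w)" "length w' \<le> m"
    using Suc.prems i(1) \<open>m = _\<close> by auto
  have "word_prod n (i # w') v = word_prod n w v" for v
    using w'(2) simple_refl_involution[OF i(1)] by simp
  then have "word_prod n (i # w') = word_prod n w" by (rule ext)
  then show ?case using w' i(1) Suc.hyps(2) by (intro exI[of _ "i # w'"]) simp
qed

lemma weyl_length_eq_height:
  assumes n: "n \<ge> 3" and w: "set w \<subseteq> index_set n"
  shows "weyl_length n (word_prod n w) = height n w"
proof (rule antisym)
  obtain w' where w': "set w' \<subseteq> index_set n" "word_prod n w' = word_prod n w" "length w' \<le> height n w"
    using word_of_height[OF n w] by blast
  then show "weyl_length n (word_prod n w) \<le> height n w" using weyl_length_le[OF w'(1)] by simp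
  obtain u where u: "set u \<subseteq> index_set n" "word_prod n u = word_prod n w"
      "length u = weyl_length n (word_prod n w)"
    by (rule weyl_length_attained[OF w])
  have "height n w = height n u" using u(2) by (simp add: height_def)
  then show "height n w \<le> weyl_length n (word_prod n w)" using height_le_length[OF n u(1)] u(3) by simp
qed

lemma negate_negate_last: "negate n (negate_last n y) = negate_last n (negate n y)"
  by (auto simp: negate_def negate_last_def fun_eq_iff)

lemma negate_negate [simp]: "negate n (negate n v) = v"
  by (auto simp: negate_def)

lemma negate_vee_map: "n \<ge> 3 \<Longrightarrow> negate n (vee_map n v) = vee_map n (negate n v)"
  by (auto simp: negate_def vee_map_def fun_eq_iff)

lemma negate_vee_map_power:
  "n \<ge> 3 \<Longrightarrow> negate n ((vee_map n ^^ k) v) = (vee_map n ^^ k) (negate n v)"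
  by (induction k) (simp_all add: negate_vee_map)

lemma opposition_involution: "n \<ge> 3 \<Longrightarrow> opposition n (opposition n v) = v"
  unfolding opposition_def
  by (simp only: negate_vee_map_power[symmetric] vee_map_power_cancel negate_negate)

text \<open>
  If a vector does not vanish at any root, its negative is negative at exactly the other positive
  roots.
\<close>

lemma inversions_negate:
  assumes "\<And>a b. (a, b) \<in> positive_pairs n \<Longrightarrow> y a \<noteq> y b \<and> y a + y b \<noteq> 0"
  shows "inversions n (negate n y) + inversions n y = n * (n + 1)"
proof -
  have "inversions n (negate n y) + inversions n y = (\<Sum>p \<in> positive_pairs n. 2)"
    unfolding inversions_def sum.distrib[symmetric]
  proof (intro sum.cong refl, clarify)
    fix a b assume ab: "(a, b) \<in> positive_pairs n"
    then have "negate n y a = - y a" "negate n y b = - y b"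
      by (auto simp: negate_def positive_pairs_def index_set_def)
    then show "defect (negate n y a) (negate n y b) + defect (y a) (y b) = 2"
      using assms[OF ab] by (auto simp: defect_def of_bool_def)
  qed
  then show ?thesis using card_positive_pairs[of n] by simp
qed

lemma height_opposition:
  assumes n: "n \<ge> 3" and w: "set w \<subseteq> index_set n"
  shows "inversions n (coords n (opposition n (word_prod n w (regular_vec n)))) + height n w = n * (n + 1)"
proof -
  let ?y = "coords n (word_prod n w (regular_vec n))" and ?r = "regular_coord n"
  obtain \<sigma> \<epsilon> where form: "\<sigma> permutes index_set n" "\<And>j. \<epsilon> j = 1 \<or> \<epsilon> j = (-1 :: int)"
      "\<And>y. signed_word n w y = (\<lambda>j. if j \<in> index_set n then \<epsilon> j * y (\<sigma> j) else y j)"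
    using signed_word_form[OF n w] by blast
  have \<sigma>I: "\<sigma> j \<in> index_set n \<longleftrightarrow> j \<in> index_set n" for j by (rule permutes_in_image[OF form(1)])
  have r: "0 < ?r (\<sigma> j)" if "j \<in> index_set n" for j
    using \<sigma>I[of j] that by (simp add: regular_coord_def index_set_def)
  have y: "?y j = ?r (\<sigma> j) \<or> ?y j = - ?r (\<sigma> j)" if "j \<in> index_set n" for j
    using that form(2)[of j] by (auto simp: coords_word_prod[OF n w] form(3) coords_regular_vec[OF n] \<sigma>I)
  have "?y a \<noteq> ?y b \<and> ?y a + ?y b \<noteq> 0" if "(a, b) \<in> positive_pairs n" for a b
  proof -
    have ab: "a \<in> index_set n" "b \<in> index_set n" "a \<noteq> b"
      using that by (auto simp: positive_pairs_def index_set_def)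
    then have "\<sigma> a \<noteq> \<sigma> b" using permutes_inj[OF form(1)] by (auto dest: injD)
    then have "?r (\<sigma> a) \<noteq> ?r (\<sigma> b)" by (simp add: regular_coord_def)
    then show ?thesis using y[OF ab(1)] y[OF ab(2)] r[OF ab(1)] r[OF ab(2)] by auto
  qed
  then have "inversions n (negate n ?y) + height n w = n * (n + 1)"
    unfolding height_def by (rule inversions_negate)
  moreover have "inversions n (negate n (coords n ((vee_map n ^^ k) v))) = inversions n (negate n (coords n v))"
    for k v
    by (induction k) (simp_all add: coords_vee_map[OF n] negate_negate_last inversions_negate_last)
  ultimately show ?thesis unfolding opposition_def coords_negate[OF n] by metis
qed

lemma twisted_word_height:
  assumes n: "n \<ge> 3" and w: "coxeter_word n w"
  shows "set (twisted_word n w) \<subseteq> index_set n" "height n (twisted_word n w) = n * (n + 1)"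
proof -
  show "set (twisted_word n w) \<subseteq> index_set n"
    unfolding twisted_word_eq by (rule twisted_power_index[OF n coxeter_wordD(3)[OF n w]])
  show "height n (twisted_word n w) = n * (n + 1)"
    using height_opposition[OF n, of "[]"] height_Nil[OF n]
    by (simp add: height_def word_prod_twisted_word[OF n w])
qed

text \<open>
  Composition with \<open>opposition\<close> replaces a height by its complement to \<open>n (n + 1)\<close>.  Hence \<open>opposition\<close>
  itself has the maximal height, and composing it with any element of this height gives an element
  of height 0, which is the identity.
\<close>

lemma longest_element_eq:
  assumes n: "n \<ge> 3"
  shows "longest_element n = opposition n"
  unfolding longest_element_def
proof (rule the_equality)
  let ?t = "twisted_word n [1..<n + 1]"
  note c = coxeter_word_upt[OF n]
  have t: "set ?t \<subseteq> index_set n" "height n ?t = n * (n + 1)" "word_prod n ?t = opposition n"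
    using twisted_word_height[OF n c] word_prod_twisted_word[OF n c] by blast+
  have len: "weyl_length n (opposition n) = n * (n + 1)"
    using weyl_length_eq_height[OF n t(1)] t by simp
  have mem: "opposition n \<in> weyl_group n"
    unfolding weyl_group_def using t by (metis image_eqI in_listsI subsetD)
  show "opposition n \<in> weyl_group n \<and> (\<forall>h \<in> weyl_group n. weyl_length n h \<le> weyl_length n (opposition n))"
  proof (intro conjI ballI)
    fix h assume "h \<in> weyl_group n"
    then obtain w where w: "set w \<subseteq> index_set n" "h = word_prod n w"
      by (auto simp: weyl_group_def)
    then show "weyl_length n h \<le> weyl_length n (opposition n)"
      using height_opposition[OF n w(1)] weyl_length_eq_height[OF n w(1)] len by simp
  qed (rule mem)
  fix g assume g: "g \<in> weyl_group n \<and> (\<forall>h \<in> weyl_group n. weyl_length n h \<le> weyl_length n g)"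
  then obtain w where w: "set w \<subseteq> index_set n" "g = word_prod n w" by (auto simp: weyl_group_def)
  have "n * (n + 1) \<le> height n w" using g mem len w weyl_length_eq_height[OF n w(1)] by metis
  then have "inversions n (coords n (opposition n (word_prod n w (regular_vec n)))) = 0"
    using height_opposition[OF n w(1)] by simp
  then have "height n (?t @ w) = 0" by (simp only: height_def word_prod_append t(3))
  then have "word_prod n (?t @ w) = id" using t(1) w(1) by (intro height_zero[OF n]) simp_all
  then have "opposition n (g v) = v" for v using w(2) t(3) by (metis id_apply word_prod_append)
  then have "g v = opposition n v" for v using opposition_involution[OF n] by metis
  then show "g = opposition n" by (rule ext)
qed

lemma twisted_word_reduced:
  assumes n: "n \<ge> 3" and w: "coxeter_word n w"
  shows "twisted_word n w \<in> reduced_words n (longest_element n)"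
proof -
  have "length (twisted_word n w) = n * (n + 1)"
    using coxeter_wordD(4)[OF n w] by (simp add: twisted_word_eq length_twisted_power)
  then show ?thesis
    using twisted_word_height[OF n w] weyl_length_eq_height[OF n twisted_word_height(1)[OF n w]]
    by (simp add: reduced_words_def reduced_iff longest_element_eq[OF n] word_prod_twisted_word[OF n w])
qed

lemma star_eq:
  assumes n: "n \<ge> 3" and i: "i \<in> index_set n"
  shows "star n i = (vee n ^^ (n + 1)) i"
proof -
  let ?j = "(vee n ^^ (n + 1)) i"
  have "vee_map n (simple_root j) = simple_root (vee n j)" for j
    by (auto simp: vee_map_def simple_root_def fun_eq_iff)
  then have "(vee_map n ^^ k) (simple_root i) = simple_root ((vee n ^^ k) i)" for k
    by (induction k) simp_all
  moreover have j: "?j \<in> index_set n" using i n vee_power_index[of n "n + 1" i] by simp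
  moreover have "negate n (simple_root j) = - simple_root j" if "j \<in> index_set n" for j
    using that by (auto simp: negate_def simple_root_def fun_Compl_def fun_eq_iff)
  ultimately have eq: "longest_element n (simple_root i) = - simple_root ?j"
    unfolding longest_element_eq[OF n] opposition_def by metis
  show ?thesis
    unfolding star_def
  proof (rule the_equality)
    show "?j \<in> index_set n \<and> longest_element n (simple_root i) = - simple_root ?j" using j eq by blast
    fix k assume "k \<in> index_set n \<and> longest_element n (simple_root i) = - simple_root k"
    then have "(- simple_root k) k = (- simple_root ?j) k" using eq by simp
    then show "k = ?j" by (simp add: simple_root_def fun_Compl_def split: if_splits)
  qed
qed

section \<open>The orbit of the standard class\<close>

text \<open>
  No letter commutes with a whole Coxeter word, since the word plays the neighbours of its vertex.
  A letter that can be moved to one end of a twisted word therefore comes from the block at this end.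
\<close>

lemma coxeter_word_blocks:
  assumes n: "n \<ge> 3" and c: "coxeter_word n w" and i: "i \<in> index_set n"
  shows "\<exists>z \<in> set w. cartan n z i \<noteq> 0"
proof -
  note d = coxeter_wordD[OF n c]
  obtain q where q: "line_adj n q (vertex n i)" using ex_line_adj[OF n] vertex_range[OF i] n by auto
  then have "q \<in> vertex n ` set w" unfolding d(2) by (auto simp: line_adj_def)
  then obtain z where z: "z \<in> set w" "vertex n z = q" by blast
  then have "cartan n z i \<noteq> 0" using cartan_zero_iff[OF n, of z i] d(3) i q by blast
  then show ?thesis using z by blast
qed

lemma twisted_word_first_letter:
  assumes n: "n \<ge> 3" and c: "coxeter_word n w" and e: "comm_eq n (twisted_word n w) (i # u)"
  obtains a where "comm_eq n w (i # a)"
proof -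
  have wI: "set w \<subseteq> index_set n" using coxeter_wordD[OF n c] by blast
  have "i \<in> set (twisted_word n w)" using comm_eq_set[OF e] by simp
  then have i: "i \<in> index_set n" using twisted_power_index[OF n wI]
    unfolding twisted_word_eq by blast
  obtain x y where xy: "twisted_word n w = x @ i # y" "\<And>j. j \<in> set x \<Longrightarrow> cartan n j i = 0"
    using comm_eq_head[OF comm_eq_sym[OF e]] by blast
  have eq: "w @ map (vee n) (twisted_power n n w) = x @ i # y"
    using xy(1) unfolding twisted_word_eq by (simp add: twisted_power_Suc_left del: twisted_power_simps)
  have "\<not> set w \<subseteq> set x" using coxeter_word_blocks[OF n c i] xy(2) by blast
  then obtain z where "w = x @ i # z"
    using eq by (auto simp: append_eq_append_conv2 append_eq_Cons_conv)
  then have "comm_eq n w (i # x @ z)" using comm_eq_move_to_front xy(2) by blast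
  then show ?thesis by (rule that)
qed

lemma twisted_word_last_letter:
  assumes n: "n \<ge> 3" and c: "coxeter_word n w" and e: "comm_eq n (twisted_word n w) (u @ [i])"
  obtains a where "comm_eq n w (a @ [(vee n ^^ n) i])"
proof -
  let ?v = "map (vee n ^^ n)"
  have wI: "set w \<subseteq> index_set n" using coxeter_wordD[OF n c] by blast
  have "i \<in> set (twisted_word n w)" using comm_eq_set[OF e] by simp
  then have i: "i \<in> index_set n" using twisted_power_index[OF n wI]
    unfolding twisted_word_eq by blast
  obtain x y where xy: "twisted_word n w = x @ i # y" "\<And>j. j \<in> set y \<Longrightarrow> cartan n j i = 0"
    using comm_eq_last[OF comm_eq_sym[OF e]] by blast
  have eq: "twisted_power n n w @ ?v w = x @ i # y" using xy(1) unfolding twisted_word_eq by simp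
  have c': "coxeter_word n (?v w)" using coxeter_word_map_vee_power[OF n] c by simp
  have "\<not> set (?v w) \<subseteq> set y" using coxeter_word_blocks[OF n c' i] xy(2) by blast
  then obtain z where z: "?v w = z @ i # y"
    using eq by (auto simp: append_eq_append_conv2 append_eq_Cons_conv)
  have "comm_eq n (rev y @ i # rev z) (i # rev y @ rev z)"
    using xy(2) by (intro comm_eq_move_to_front) simp
  from comm_eq_rev[OF this] have "comm_eq n (?v w) (z @ y @ [i])" using z by simp
  from comm_eq_map_vee_power[OF n this, of n]
  have "comm_eq n w (?v (z @ y) @ [(vee n ^^ n) i])" by (simp add: comp_def)
  then show ?thesis by (rule that)
qed

lemma reflection_orbit_twisted:
  assumes n: "n \<ge> 3" and "C \<in> reflection_orbit n"
  shows "\<exists>w. coxeter_word n w \<and> C = comm_class n (twisted_word n w)"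
  using assms(2)
proof (induction rule: reflection_orbit.induct)
  case base
  show ?case using coxeter_word_upt[OF n] by blast
next
  case (first_to_last C i u)
  then obtain w where w: "coxeter_word n w" "C = comm_class n (twisted_word n w)" by blast
  then have e: "comm_eq n (twisted_word n w) (i # u)"
    using first_to_last.hyps(2) by (simp add: comm_class_def)
  from twisted_word_first_letter[OF n w(1) e] obtain a where a: "comm_eq n w (i # a)" .
  have c: "coxeter_word n (i # a)" using coxeter_word_comm_eq[OF n a] w(1) by simp
  have c': "coxeter_word n (a @ [vee n i])" using coxeter_word_rotate[OF n, of a "[i]"] c by simp
  have i: "i \<in> index_set n" using coxeter_wordD(3)[OF n c] by simp
  have "comm_eq n (i # u) (twisted_word n (i # a))"
    using rtranclp_trans[OF comm_eq_sym[OF e]] twisted_power_comm_eq[OF n a] twisted_word_eq by metis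
  from comm_eq_append2[OF this, of "[star n i]"]
  have "comm_eq n (i # u @ [star n i]) (i # twisted_word n (a @ [vee n i]))"
    using twisted_power_rotate[of i n "n + 1" a] star_eq[OF n i] twisted_word_eq by (metis append_Cons)
  then have "comm_eq n (u @ [star n i]) (twisted_word n (a @ [vee n i]))" by (rule comm_eq_cancel_left)
  then show ?case using c' comm_class_eq_iff by blast
next
  case (last_to_first C u i)
  then obtain w where w: "coxeter_word n w" "C = comm_class n (twisted_word n w)" by blast
  then have e: "comm_eq n (twisted_word n w) (u @ [i])"
    using last_to_first.hyps(2) by (simp add: comm_class_def)
  let ?j = "(vee n ^^ (n + 1)) i"
  have j: "vee n ?j = (vee n ^^ n) i" by simp
  from twisted_word_last_letter[OF n w(1) e] obtain a where a: "comm_eq n w (a @ [vee n ?j])"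
    unfolding j .
  have c: "coxeter_word n (a @ [vee n ?j])" using coxeter_word_comm_eq[OF n a] w(1) by simp
  have c': "coxeter_word n (?j # a)" using coxeter_word_rotate[OF n, of a "[?j]"] c by simp
  have "?j \<in> index_set n" using coxeter_wordD(3)[OF n c'] by simp
  then have i: "i \<in> index_set n" using n vee_power_index[of n "n + 1" i] by simp
  have "comm_eq n (u @ [i]) (twisted_word n (a @ [vee n ?j]))"
    using rtranclp_trans[OF comm_eq_sym[OF e]] twisted_power_comm_eq[OF n a] twisted_word_eq by metis
  from comm_eq_append1[OF this, of "[star n i]"]
  have "comm_eq n (star n i # u @ [i]) (?j # twisted_power n (n + 1) (a @ [vee n ?j]))"
    using star_eq[OF n i] twisted_word_eq by simp
  also have "?j # twisted_power n (n + 1) (a @ [vee n ?j]) = twisted_word n (?j # a) @ [i]"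
    unfolding twisted_power_rotate twisted_word_eq vee_power_cancel ..
  finally have "comm_eq n ((star n i # u) @ [i]) (twisted_word n (?j # a) @ [i])" by simp
  then have "comm_eq n (star n i # u) (twisted_word n (?j # a))" by (rule comm_eq_cancel_right)
  then show ?case using c' comm_class_eq_iff by blast
qed

lemma twisted_reflection_orbit:
  assumes n: "n \<ge> 3" and w: "coxeter_word n w"
  shows "comm_class n (twisted_word n w) \<in> reflection_orbit n"
  using n w
proof (induction rule: coxeter_word_induct)
  case base
  show ?case by (rule reflection_orbit.base)
next
  case (comm u v)
  then have "comm_eq n (twisted_word n u) (twisted_word n v)"
    using twisted_power_comm_eq[OF n] unfolding twisted_word_eq by blast
  then show ?case using comm.IH comm_class_eq_iff by metis
next
  case (rot i a)
  let ?j = "(vee n ^^ (n + 1)) i"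
  have i: "i \<in> index_set n" using coxeter_wordD(3)[OF n rot.hyps] by simp
  then have j: "?j \<in> index_set n" using n by simp
  have eq: "i # twisted_word n (a @ [vee n i]) = twisted_word n (i # a) @ [?j]"
    using twisted_power_rotate[of i n "n + 1" a] twisted_word_eq by simp
  have "twisted_word n (i # a) = i # tl (twisted_word n (i # a))"
    unfolding twisted_word_eq by (simp add: twisted_power_Suc_left del: twisted_power_simps)
  then obtain r where r: "twisted_word n (i # a) = i # r" by blast
  then have "twisted_word n (a @ [vee n i]) = r @ [?j]" using eq by simp
  then have "r @ [?j] \<in> comm_class n (twisted_word n (a @ [vee n i]))" by (simp add: comm_class_def)
  from reflection_orbit.last_to_first[OF rot.IH this]
  have "comm_class n (star n ?j # r) \<in> reflection_orbit n" .
  moreover have "star n ?j = i" unfolding star_eq[OF n j] by (rule vee_power_cancel)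
  ultimately show ?case using r by simp
qed

section \<open>Coxeter elements, quivers and adapted classes\<close>

text \<open>
  A Coxeter word is reduced, so if the element corresponds to \<open>Q\<close> the word is a sink sequence and
  \<open>Q\<close> is its quiver.  Conversely all reduced words differ from the Coxeter word by commutations,
  which preserve sink sequences.
\<close>

lemma corresponds_iff:
  assumes n: "n \<ge> 3" and Q: "Q \<in> twisted_quivers n"
  shows "corresponds n Q g \<longleftrightarrow> (\<exists>w. coxeter_word n w \<and> g = word_prod n w \<and> quiver_of n w = Q)"
proof
  assume g: "corresponds n Q g"
  then obtain w where w: "coxeter_word n w" "g \<circ> vee_map n = word_prod n w \<circ> vee_map n"
    by (auto simp: corresponds_def twisted_coxeter_elements_def)
  note d = coxeter_wordD[OF n w(1)]
  have "g v = word_prod n w v" for v using fun_cong[OF w(2), of "vee_map n v"] by simp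
  then have gw: "g = word_prod n w" by (rule ext)
  then have "w \<in> reduced_words n g"
    using distinct_word_reduced[OF d(5,3)] by (simp add: reduced_words_def)
  then have "sink_word n Q w" using g by (simp add: corresponds_def adapted_iff)
  then have "Q = quiver_of n w" by (rule sink_word_quiver_of[OF n Q _ d(6)])
  then show "\<exists>w. coxeter_word n w \<and> g = word_prod n w \<and> quiver_of n w = Q" using w(1) gw by blast
next
  assume "\<exists>w. coxeter_word n w \<and> g = word_prod n w \<and> quiver_of n w = Q"
  then obtain w where w: "coxeter_word n w" "g = word_prod n w" "quiver_of n w = Q" by blast
  note d = coxeter_wordD[OF n w(1)]
  have "adapted n Q u" if "u \<in> reduced_words n g" for u
  proof -
    have u: "reduced n u" "word_prod n u = word_prod n w" using that w(2) by (simp_all add: reduced_words_def)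
    have "comm_eq n w u" by (rule reduced_words_distinct[OF d(5,3) u])
    moreover have "sink_word n Q w" using coxeter_sink_word(1)[OF n w(1)] w(3) by simp
    ultimately show ?thesis using sink_word_comm_eq[OF n Q] u(1) by (simp add: adapted_iff)
  qed
  then show "corresponds n Q g"
    using w(1,2) by (auto simp: corresponds_def twisted_coxeter_elements_def)
qed

lemma corresponds_unique:
  assumes n: "n \<ge> 3" and Q: "Q \<in> twisted_quivers n" and g: "corresponds n Q g" "corresponds n Q h"
  shows "g = h"
proof -
  obtain u w where "coxeter_word n u" "g = word_prod n u" "quiver_of n u = Q"
      "coxeter_word n w" "h = word_prod n w" "quiver_of n w = Q"
    using g corresponds_iff[OF n Q] by blast
  then show ?thesis using word_prod_comm_eq coxeter_same_quiver[OF n] by metis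
qed

lemma phi_quiver_of:
  assumes n: "n \<ge> 3" and w: "coxeter_word n w"
  shows "phi_quiver n (quiver_of n w) = word_prod n w"
proof -
  have Q: "quiver_of n w \<in> twisted_quivers n"
    using quiver_of_twisted_quivers coxeter_wordD(6)[OF n w] by blast
  have "corresponds n (quiver_of n w) (word_prod n w)" using corresponds_iff[OF n Q] w by blast
  then show ?thesis
    unfolding phi_quiver_def using corresponds_unique[OF n Q] by (intro the_equality) blast+
qed

lemma twisted_quivers_eq:
  assumes n: "n \<ge> 3"
  shows "twisted_quivers n = quiver_of n ` {w. coxeter_word n w}"
proof (intro equalityI subsetI)
  fix Q assume "Q \<in> twisted_quivers n"
  then obtain w where "coxeter_word n w" "quiver_of n w = Q" by (rule ex_coxeter_word_quiver[OF n])
  then show "Q \<in> quiver_of n ` {w. coxeter_word n w}" by blast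
next
  fix Q assume "Q \<in> quiver_of n ` {w. coxeter_word n w}"
  then show "Q \<in> twisted_quivers n"
    using quiver_of_twisted_quivers coxeter_wordD(6)[OF n] by blast
qed

text \<open>
  Coxeter words for the same element differ by commutations, so they are sink sequences of the same
  quivers.
\<close>

lemma coxeter_quiver_inject:
  assumes n: "n \<ge> 3" and c: "coxeter_word n u" "coxeter_word n w" and eq: "word_prod n u = word_prod n w"
  shows "quiver_of n u = quiver_of n w"
proof -
  note du = coxeter_wordD[OF n c(1)] and dw = coxeter_wordD[OF n c(2)]
  have "comm_eq n u w"
    using distinct_word_reduced[OF dw(5,3)] eq by (intro reduced_words_distinct[OF du(5,3)]) simp_all
  then have "sink_word n (quiver_of n u) w"
    using sink_word_comm_eq[OF n quiver_of_twisted_quivers[OF du(6)]] coxeter_sink_word(1)[OF n c(1)]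
    by blast
  then show ?thesis by (rule sink_word_quiver_of[OF n quiver_of_twisted_quivers[OF du(6)] _ dw(6)])
qed

lemma covers_twisted_word: "n \<ge> 3 \<Longrightarrow> coxeter_word n w \<Longrightarrow> covers n (twisted_word n w)"
  using coxeter_wordD(6)[of n w]
  unfolding covers_def twisted_word_eq Suc_eq_plus1[symmetric] twisted_power_Suc_left by auto

lemma twisted_class_sink_word:
  assumes n: "n \<ge> 3" and w: "coxeter_word n w" and u: "u \<in> comm_class n (twisted_word n w)"
  shows "sink_word n (quiver_of n w) u"
proof -
  have "quiver_of n w \<in> twisted_quivers n"
    using quiver_of_twisted_quivers coxeter_wordD(6)[OF n w] by blast
  then show ?thesis
    using sink_word_comm_eq[OF n] coxeter_sink_word(2)[OF n w] u by (simp add: comm_class_def)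
qed

text \<open>
  A word that plays every vertex is a sink sequence of one quiver only; so the class of a twisted
  word determines the quiver, and with it the Coxeter element.
\<close>

lemma phi_class_twisted_word:
  assumes n: "n \<ge> 3" and w: "coxeter_word n w"
  shows "phi_class n (comm_class n (twisted_word n w)) = word_prod n w"
  unfolding phi_class_def
proof (rule the_equality)
  fix g
  assume "\<exists>u. coxeter_word n u \<and> g = word_prod n u \<and>
    comm_class n (twisted_word n w) = comm_class n (twisted_word n u)"
  then obtain u where u: "coxeter_word n u" "g = word_prod n u"
      "comm_class n (twisted_word n w) = comm_class n (twisted_word n u)" by blast
  have "twisted_word n w \<in> comm_class n (twisted_word n u)"
    unfolding u(3)[symmetric] by (simp add: comm_class_def)
  then have "sink_word n (quiver_of n u) (twisted_word n w)" by (rule twisted_class_sink_word[OF n u(1)])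
  moreover have "quiver_of n u \<in> twisted_quivers n" "quiver_of n w \<in> twisted_quivers n"
    using u(1) w twisted_quivers_eq[OF n] by blast+
  ultimately have "quiver_of n u = quiver_of n w"
    using sink_word_quiver_of[OF n _ _ covers_twisted_word[OF n w]] coxeter_sink_word(2)[OF n w]
    by metis
  then show "g = word_prod n w"
    using u(2) word_prod_comm_eq[OF coxeter_same_quiver[OF n u(1) w]] by simp
qed (use w in blast)

lemma twisted_adapted_classes_eq:
  assumes n: "n \<ge> 3"
  shows "twisted_adapted_classes n = (\<lambda>w. comm_class n (twisted_word n w)) ` {w. coxeter_word n w}"
proof (intro equalityI subsetI)
  fix C assume "C \<in> twisted_adapted_classes n"
  then have "C \<in> reflection_orbit n" by (simp add: twisted_adapted_classes_def)
  then obtain w where "coxeter_word n w" "C = comm_class n (twisted_word n w)"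
    using reflection_orbit_twisted[OF n] by blast
  then show "C \<in> (\<lambda>w. comm_class n (twisted_word n w)) ` {w. coxeter_word n w}" by blast
next
  fix C assume "C \<in> (\<lambda>w. comm_class n (twisted_word n w)) ` {w. coxeter_word n w}"
  then obtain w where w: "coxeter_word n w" "C = comm_class n (twisted_word n w)" by blast
  have "C \<in> reflection_orbit n"
    unfolding w(2) by (rule twisted_reflection_orbit[OF n w(1)])
  then show "C \<in> twisted_adapted_classes n"
    using twisted_word_reduced[OF n w(1)] w(2) by (auto simp: twisted_adapted_classes_def)
qed

theorem proposition7p8:
  fixes n :: nat
  assumes "n \<ge> 3"
  shows "((\<forall>Q \<in> twisted_quivers n. \<exists>!g. corresponds n Q g) \<and>
      bij_betw (\<lambda>Q. phi_quiver n Q \<circ> vee_map n)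
        (twisted_quivers n) (twisted_coxeter_elements n)) \<and>
    phi_quiver n ` twisted_quivers n = phi_class n ` twisted_adapted_classes n \<and>
    (\<forall>C \<in> twisted_adapted_classes n. \<forall>Q \<in> twisted_quivers n.
      phi_class n C = phi_quiver n Q \<longrightarrow> (\<forall>w \<in> C. adapted n Q w))"
proof (intro conjI ballI impI)
  note n = assms
  fix Q assume Q: "Q \<in> twisted_quivers n"
  obtain w where w: "coxeter_word n w" "quiver_of n w = Q" by (rule ex_coxeter_word_quiver[OF n Q])
  have *: "corresponds n Q (word_prod n w)" unfolding corresponds_iff[OF n Q] using w by blast
  show "\<exists>!g. corresponds n Q g"
    using corresponds_unique[OF n Q _ *] by (rule ex1I[of "corresponds n Q", OF *])
next
  note n = assms
  show "bij_betw (\<lambda>Q. phi_quiver n Q \<circ> vee_map n) (twisted_quivers n) (twisted_coxeter_elements n)"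
  proof (rule bij_betw_imageI)
    show "inj_on (\<lambda>Q. phi_quiver n Q \<circ> vee_map n) (twisted_quivers n)"
    proof (rule inj_onI)
      fix Q Q' assume "Q \<in> twisted_quivers n" "Q' \<in> twisted_quivers n"
        and eq: "phi_quiver n Q \<circ> vee_map n = phi_quiver n Q' \<circ> vee_map n"
      then obtain u w where u: "coxeter_word n u" "Q = quiver_of n u"
        and w: "coxeter_word n w" "Q' = quiver_of n w"
        unfolding twisted_quivers_eq[OF n] by blast
      have "word_prod n u v = word_prod n w v" for v
        using fun_cong[OF eq, of "vee_map n v"] u w phi_quiver_of[OF n] by simp
      then have "word_prod n u = word_prod n w" by (rule ext)
      then show "Q = Q'" using coxeter_quiver_inject[OF n u(1) w(1)] u(2) w(2) by simp
    qed
    show "(\<lambda>Q. phi_quiver n Q \<circ> vee_map n) ` twisted_quivers n = twisted_coxeter_elements n"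
      unfolding twisted_quivers_eq[OF n] twisted_coxeter_elements_def image_image
      using phi_quiver_of[OF n] by (auto simp: image_iff)
  qed
next
  note n = assms
  show "phi_quiver n ` twisted_quivers n = phi_class n ` twisted_adapted_classes n"
    unfolding twisted_quivers_eq[OF n] twisted_adapted_classes_eq[OF n] image_image
    using phi_quiver_of[OF n] phi_class_twisted_word[OF n] by (intro image_cong) simp_all
next
  note n = assms
  fix C Q u
  assume "C \<in> twisted_adapted_classes n" "Q \<in> twisted_quivers n"
    and eq: "phi_class n C = phi_quiver n Q" and u: "u \<in> C"
  then obtain w x where w: "coxeter_word n w" "C = comm_class n (twisted_word n w)"
    and x: "coxeter_word n x" "Q = quiver_of n x"
    unfolding twisted_quivers_eq[OF n] twisted_adapted_classes_eq[OF n] by blast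
  have "word_prod n w = word_prod n x"
    using eq phi_class_twisted_word[OF n w(1)] phi_quiver_of[OF n x(1)] w(2) x(2) by simp
  then have "Q = quiver_of n w" using coxeter_quiver_inject[OF n w(1) x(1)] x(2) by simp
  moreover have "sink_word n (quiver_of n w) u" using twisted_class_sink_word[OF n w(1)] u w(2) by simp
  moreover have "reduced n u"
    using twisted_word_reduced[OF n w(1)] reduced_comm_eq[of n "twisted_word n w" u] u w(2)
    by (simp add: reduced_words_def comm_class_def)
  ultimately show "adapted n Q u" by (simp add: adapted_iff)
qed

end
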